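(* In the setting below, assume $\tau$ and $w$ are smooth along $\gamma$. Then there is a function $B(s)$ such that $$l(s)\sin\delta\,\big(k(s)l(s)-\sin\delta\big)\,\dot\tau(s)+B(s)\tau(s)=0 .$$ Moreover, if $\tau(s_0)=0$ for some $s_0$ (i.e. $\dot n(s_0)+k(s_0)v(s_0)=0$), then $\tau\equiv 0$ along $\gamma$.
   Context: Let $S\subset\mathbf{R}^d$ be a Gutkin billiard table for the angle $\delta\in(0,\pi/2)$: a smooth closed hypersurface bounding a compact convex domain, with all principal curvatures strictly positive, such that for all distinct $p,q\in S$, if the angle between $\overrightarrow{pq}$ and $T_pS$ equals $\delta$ then the angle between $\overrightarrow{pq}$ and $T_qS$ equals $\delta$. Let $\gamma(s)$ be an arc-length parametrized geodesic of $S$, $v=\dot\gamma$, $n(s)$ the unit inner normal of $S$ at $\gamma(s)$. Since $\gamma$ is a geodesic, $\dot v=k(s)n(s)$ with curvature $k(s)>0$. Write $\frac{d}{ds}n(s)=-k(s)v(s)+\tau(s)w(s)$ where $w(s)$ is a unit vector orthogonal to $v(s)$ and $n(s)$. Let $z(s)=\cos\delta\,v(s)+\sin\delta\,n(s)$ and let $l(s)>0$ be the length of the chord of $S$ from $\gamma(s)$ in direction $z(s)$. *)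

theory Defs
  imports "HOL-Analysis.Analysis"
begin

fun Ck_on :: "nat \<Rightarrow> 'a::real_normed_vector set \<Rightarrow> ('a \<Rightarrow> 'b::real_normed_vector) \<Rightarrow> bool" where
  "Ck_on 0 U f = continuous_on U f"
| "Ck_on (Suc m) U f =
     (f differentiable_on U \<and> (\<forall>h. Ck_on m U (\<lambda>x. frechet_derivative f (at x) h)))"

definition smooth_map_on :: "'a::real_normed_vector set \<Rightarrow> ('a \<Rightarrow> 'b::real_normed_vector) \<Rightarrow> bool" where
  "smooth_map_on U f \<longleftrightarrow> (\<forall>m. Ck_on m U f)"

definition grad :: "('a::euclidean_space \<Rightarrow> real) \<Rightarrow> 'a \<Rightarrow> 'a" where
  "grad F x = (\<Sum>i\<in>Basis. frechet_derivative F (at x) i *\<^sub>R i)"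

definition hess :: "('a::euclidean_space \<Rightarrow> real) \<Rightarrow> 'a \<Rightarrow> 'a \<Rightarrow> real" where
  "hess F x t = frechet_derivative (\<lambda>y. frechet_derivative F (at y) t) (at x) t"

text \<open>The hypersurface S = {F = 0} bounds the domain {F \<le> 0}; the tangent space at p is the
  orthogonal complement of grad F p, and the unit inner normal is - grad F / |grad F|.\<close>
definition tangent_space :: "('a::euclidean_space \<Rightarrow> real) \<Rightarrow> 'a \<Rightarrow> 'a set" where
  "tangent_space F p = {t. t \<bullet> grad F p = 0}"

definition inner_normal :: "('a::euclidean_space \<Rightarrow> real) \<Rightarrow> 'a \<Rightarrow> 'a" where
  "inner_normal F p = - ((1 / norm (grad F p)) *\<^sub>R grad F p)"

text \<open>Angle between a nonzero vector u and the hyperplane T_pS (= complement of the angle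
  between u and the normal line).\<close>
definition angle_to_tangent :: "('a::euclidean_space \<Rightarrow> real) \<Rightarrow> 'a \<Rightarrow> 'a \<Rightarrow> real" where
  "angle_to_tangent F p u = arcsin (\<bar>u \<bullet> grad F p\<bar> / (norm u * norm (grad F p)))"

text \<open>S = {x. F x = 0} is a smooth closed hypersurface bounding the compact convex domain
  {x. F x \<le> 0}, with all principal curvatures strictly positive (second fundamental form,
  i.e. the Hessian of F restricted to the tangent space, positive definite).\<close>
definition smooth_convex_hypersurface :: "('a::euclidean_space \<Rightarrow> real) \<Rightarrow> bool" where
  "smooth_convex_hypersurface F \<longleftrightarrow>
     smooth_map_on UNIV F \<and>
     compact {x. F x \<le> 0} \<and> convex {x. F x \<le> 0} \<and> {x. F x = 0} \<noteq> {} \<and>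
     (\<forall>p. F p = 0 \<longrightarrow> grad F p \<noteq> 0) \<and>
     (\<forall>p t. F p = 0 \<longrightarrow> t \<in> tangent_space F p \<longrightarrow> t \<noteq> 0 \<longrightarrow> hess F p t > 0)"

definition gutkin_table :: "('a::euclidean_space \<Rightarrow> real) \<Rightarrow> real \<Rightarrow> bool" where
  "gutkin_table F \<delta> \<longleftrightarrow>
     smooth_convex_hypersurface F \<and>
     (\<forall>p q. F p = 0 \<longrightarrow> F q = 0 \<longrightarrow> p \<noteq> q \<longrightarrow>
        angle_to_tangent F p (q - p) = \<delta> \<longrightarrow> angle_to_tangent F q (q - p) = \<delta>)"

definition arclength_geodesic :: "('a::euclidean_space \<Rightarrow> real) \<Rightarrow> (real \<Rightarrow> 'a) \<Rightarrow> bool" where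
  "arclength_geodesic F \<gamma> \<longleftrightarrow>
     smooth_map_on UNIV \<gamma> \<and>
     (\<forall>s. F (\<gamma> s) = 0) \<and>
     (\<forall>s. norm (vector_derivative \<gamma> (at s)) = 1) \<and>
     (\<forall>s. \<exists>c. vector_derivative (\<lambda>r. vector_derivative \<gamma> (at r)) (at s)
              = c *\<^sub>R inner_normal F (\<gamma> s))"

end

theory Submission
  imports Defs
begin

text \<open>
  Let \<open>z\<close> be a chord direction making the angle \<open>\<delta>\<close> with the table at \<open>p\<close>, let \<open>q = p + L z\<close>
  be the exit point and \<open>N\<close> the inner normal there. Every first-order variation of \<open>(p, z)\<close> that
  keeps the entry angle comes from a family of chords, hence also keeps the exit angle. Since the
  shape operators at both ends are self-adjoint, this says that one linear functional vanishes on
  the kernel of another, and the resulting multiplier \<open>\<rho>\<close> determines \<open>N\<close> together with the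
  derivative of the normal at \<open>q\<close>. Along a geodesic it gives \<open>\<rho> = cos \<delta> / (l' + cos \<delta>)\<close>,
  \<open>N \<bullet> w = \<rho> l \<tau> cos \<delta>\<close> and \<open>N' \<bullet> w = - g \<tau>\<close> with continuous \<open>g\<close>, while
  \<open>N \<bullet> w'\<close> is a continuous multiple of \<open>\<tau>\<close>. Comparing with the derivative of \<open>N \<bullet> w\<close> yields a linear
  equation \<open>\<tau>' = C \<tau>\<close> with continuous \<open>C\<close>, since \<open>\<rho>\<close> and \<open>l\<close> have no zeros.
\<close>

section \<open>Symmetry of second derivatives\<close>

lemma Ck_on_Suc_has_derivative:
  assumes "Ck_on (Suc m) UNIV f"
  shows "(f has_derivative frechet_derivative f (at x)) (at x)"
  using assms by (simp add: differentiable_on_def frechet_derivative_works)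

lemma continuous_directional_derivative:
  assumes "Ck_on (Suc 0) UNIV f"
  shows "continuous_on UNIV (\<lambda>x. frechet_derivative f (at x) h)"
  using assms by simp

lemma has_derivative_along_line:
  fixes f :: "'a::real_normed_vector \<Rightarrow> real"
  assumes "\<And>x. (f has_derivative f' x) (at x)"
  shows "((\<lambda>t. f (x + t *\<^sub>R h)) has_real_derivative f' (x + t *\<^sub>R h) h) (at t)"
proof -
  have lin: "linear (f' (x + t *\<^sub>R h))"
    using assms has_derivative_linear by blast
  have "((\<lambda>t. x + t *\<^sub>R h) has_derivative (\<lambda>s. s *\<^sub>R h)) (at t)"
    by (auto intro!: derivative_eq_intros)
  from has_derivative_compose[OF this assms] show ?thesis
    by (simp add: has_field_derivative_def linear_cmul[OF lin] mult.commute[of _ "f' _ h"])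
qed

text \<open>The mean value theorem is applied twice: to the increment of \<open>f\<close> in
  direction \<open>k\<close>, moved along \<open>h\<close>, and then to \<open>f' _ h\<close> along
  \<open>k\<close>. Bounding \<open>a\<close> and \<open>b\<close> by \<open>s\<close> is enough to
  place the evaluation point near \<open>x\<close>.\<close>

lemma second_difference_mean_value:
  fixes f :: "'a::real_normed_vector \<Rightarrow> real"
  assumes f: "\<And>x. (f has_derivative f' x) (at x)"
    and f2: "\<And>x. ((\<lambda>y. f' y h) has_derivative f'' x) (at x)"
    and "0 < s"
  shows "\<exists>a b. \<bar>a\<bar> \<le> s \<and> \<bar>b\<bar> \<le> s \<and>
    f (x + s *\<^sub>R h + s *\<^sub>R k) - f (x + s *\<^sub>R h) - f (x + s *\<^sub>R k) + f x
      = s * s * f'' (x + a *\<^sub>R h + b *\<^sub>R k) k"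
proof -
  let ?g = "\<lambda>t. f ((x + s *\<^sub>R k) + t *\<^sub>R h) - f (x + t *\<^sub>R h)"
  let ?g' = "\<lambda>t. f' ((x + s *\<^sub>R k) + t *\<^sub>R h) h - f' (x + t *\<^sub>R h) h"
  have "\<exists>a. 0 < a \<and> a < s \<and> ?g s - ?g 0 = (s - 0) * ?g' a"
    by (rule MVT2[OF \<open>0 < s\<close>]) (intro DERIV_diff has_derivative_along_line f)
  then obtain a where a: "0 < a" "a < s"
    "?g s - ?g 0 = (s - 0) * (f' ((x + s *\<^sub>R k) + a *\<^sub>R h) h - f' (x + a *\<^sub>R h) h)"
    by blast
  have "\<exists>b. 0 < b \<and> b < s \<and> f' (x + a *\<^sub>R h + s *\<^sub>R k) h - f' (x + a *\<^sub>R h + 0 *\<^sub>R k) h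
      = (s - 0) * f'' (x + a *\<^sub>R h + b *\<^sub>R k) k"
    by (rule MVT2[OF \<open>0 < s\<close>]) (rule has_derivative_along_line[of "\<lambda>y. f' y h", OF f2])
  then obtain b where b: "0 < b" "b < s"
    "f' (x + a *\<^sub>R h + s *\<^sub>R k) h - f' (x + a *\<^sub>R h + 0 *\<^sub>R k) h
       = (s - 0) * f'' (x + a *\<^sub>R h + b *\<^sub>R k) k"
    by blast
  show ?thesis
    using a b by (intro exI[of _ a] exI[of _ b]) (auto simp: algebra_simps)
qed

text \<open>The second difference of \<open>f\<close> does not change when \<open>h\<close> and
  \<open>k\<close> are exchanged, so a value of \<open>D h k\<close> near \<open>x\<close> equals a
  value of \<open>D k h\<close> near \<open>x\<close>. Continuity of both at \<open>x\<close> then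
  excludes a gap.\<close>

lemma second_derivative_symmetric:
  fixes f :: "'a::real_normed_vector \<Rightarrow> real"
  assumes f: "Ck_on (Suc (Suc 0)) UNIV f"
  defines "D \<equiv> \<lambda>h k x. frechet_derivative (\<lambda>y. frechet_derivative f (at y) h) (at x) k"
  shows "D h k x = D k h x"
proof (rule ccontr)
  assume ne: "D h k x \<noteq> D k h x"
  define e where "e = \<bar>D h k x - D k h x\<bar> / 2"
  have "e > 0" using ne by (simp add: e_def)
  have C1: "Ck_on (Suc 0) UNIV (\<lambda>y. frechet_derivative f (at y) h)" for h
    using f by simp
  have f1: "\<And>x. (f has_derivative frechet_derivative f (at x)) (at x)"
    by (rule Ck_on_Suc_has_derivative[OF f])
  have f2: "\<And>x. ((\<lambda>y. frechet_derivative f (at y) h) has_derivative (\<lambda>k. D h k x)) (at x)" for h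
    unfolding D_def by (rule Ck_on_Suc_has_derivative[OF C1])
  have cont: "isCont (D h k) x" for h k
    using continuous_directional_derivative[OF C1] unfolding D_def
    by (simp add: continuous_on_eq_continuous_at)
  have "\<exists>d>0. \<forall>y. dist y x < d \<longrightarrow> dist (D h k y) (D h k x) < e" for h k
    using cont[of h k] \<open>e > 0\<close> unfolding continuous_at_eps_delta by blast
  then obtain d1 d2 where d1: "d1 > 0" "\<And>y. dist y x < d1 \<Longrightarrow> dist (D h k y) (D h k x) < e"
    and d2: "d2 > 0" "\<And>y. dist y x < d2 \<Longrightarrow> dist (D k h y) (D k h x) < e"
    by meson
  \<comment> \<open>Steps of this size keep both evaluation points within \<open>min d1 d2\<close>
    of \<open>x\<close>; the summand \<open>1\<close> keeps the denominator positive when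
    \<open>h\<close> and \<open>k\<close> vanish.\<close>
  define s where "s = min d1 d2 / (2 * (norm h + norm k + 1))"
  have "s > 0" using d1 d2 by (simp add: s_def add_nonneg_pos)
  \<comment> \<open>Stated for arbitrary \<open>h'\<close> and \<open>k'\<close> with the same sum
    of norms because it is used for both orders of \<open>h\<close> and \<open>k\<close>.\<close>
  have near: "dist (x + a *\<^sub>R h' + b *\<^sub>R k') x < min d1 d2"
    if "\<bar>a\<bar> \<le> s" "\<bar>b\<bar> \<le> s" "norm h' + norm k' = norm h + norm k" for a b h' k'
  proof -
    have "norm (a *\<^sub>R h' + b *\<^sub>R k') \<le> \<bar>a\<bar> * norm h' + \<bar>b\<bar> * norm k'"
      by (rule order_trans[OF norm_triangle_ineq]) simp
    also have "\<dots> \<le> s * norm h' + s * norm k'"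
      using that by (intro add_mono mult_right_mono) auto
    also have "\<dots> = s * (norm h + norm k)"
      using that by (metis distrib_left)
    also have "\<dots> < s * (2 * (norm h + norm k + 1))"
      using \<open>s > 0\<close> by (intro mult_strict_left_mono) (auto simp: add_nonneg_pos)
    also have "\<dots> = min d1 d2"
      unfolding s_def by (smt (verit, best) nonzero_mult_div_cancel_right norm_ge_zero times_divide_eq_left)
    finally show ?thesis by (simp add: dist_norm add.assoc)
  qed
  obtain a b where ab: "\<bar>a\<bar> \<le> s" "\<bar>b\<bar> \<le> s"
    "f (x + s *\<^sub>R h + s *\<^sub>R k) - f (x + s *\<^sub>R h) - f (x + s *\<^sub>R k) + f x
      = s * s * D h k (x + a *\<^sub>R h + b *\<^sub>R k)"
    using second_difference_mean_value[OF f1 f2 \<open>s > 0\<close>] by blast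
  obtain a' b' where ab': "\<bar>a'\<bar> \<le> s" "\<bar>b'\<bar> \<le> s"
    "f (x + s *\<^sub>R k + s *\<^sub>R h) - f (x + s *\<^sub>R k) - f (x + s *\<^sub>R h) + f x
      = s * s * D k h (x + a' *\<^sub>R k + b' *\<^sub>R h)"
    using second_difference_mean_value[OF f1 f2 \<open>s > 0\<close>] by blast
  have "s * s * D h k (x + a *\<^sub>R h + b *\<^sub>R k) = s * s * D k h (x + a' *\<^sub>R k + b' *\<^sub>R h)"
    using ab(3) ab'(3) by (simp add: algebra_simps)
  then have eq: "D h k (x + a *\<^sub>R h + b *\<^sub>R k) = D k h (x + a' *\<^sub>R k + b' *\<^sub>R h)"
    using \<open>s > 0\<close> by simp
  have "dist (D h k (x + a *\<^sub>R h + b *\<^sub>R k)) (D h k x) < e"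
    by (rule d1) (use near[OF ab(1,2), of h k] in simp)
  moreover have "dist (D k h (x + a' *\<^sub>R k + b' *\<^sub>R h)) (D k h x) < e"
    by (rule d2) (use near[OF ab'(1,2), of k h] in simp)
  moreover have "\<bar>D h k x - D k h x\<bar> = 2 * e"
    by (simp add: e_def)
  ultimately show False
    unfolding eq dist_real_def by (smt (verit))
qed

section \<open>Zeros along a moving line\<close>

lemma isCont_iff_tendsto_nhds: "isCont f x \<longleftrightarrow> (f \<longlongrightarrow> f x) (nhds x)"
  by (simp add: isCont_def tendsto_at_iff_tendsto_nhds)

text \<open>A pointwise form of the implicit function theorem. Positive slope makes \<open>F\<close>
  change sign across \<open>r0\<close> on the line at \<open>t0\<close>, the sign change persists
  for nearby \<open>t\<close>, and the intermediate value theorem yields zeros arbitrarily close to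
  \<open>r0\<close>. The zero nearest to \<open>r0\<close> is then continuous at
  \<open>t0\<close>.\<close>

lemma continuous_zero_selection:
  fixes F :: "'a::real_normed_vector \<Rightarrow> real" and c d :: "real \<Rightarrow> 'a"
  assumes F: "continuous_on UNIV F"
    and c: "isCont c t0" and d: "isCont d t0"
    and zero: "F (c t0 + r0 *\<^sub>R d t0) = 0"
    and der: "((\<lambda>r. F (c t0 + r *\<^sub>R d t0)) has_real_derivative D) (at r0)" and "0 < D"
  shows "\<exists>r. r t0 = r0 \<and> isCont r t0 \<and> (\<forall>\<^sub>F t in nhds t0. F (c t + r t *\<^sub>R d t) = 0)"
proof -
  define Z where "Z t = {r. F (c t + r *\<^sub>R d t) = 0}" for t
  \<comment> \<open>Where \<open>Z t\<close> is empty this value is unspecified, which is harmless: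
    \<open>near\<close> shows that \<open>Z t\<close> is nonempty for all \<open>t\<close> close to
    \<open>t0\<close>.\<close>
  define r where "r t = closest_point (Z t) r0" for t
  have contF: "isCont F x" for x
    using F by (simp add: continuous_on_eq_continuous_at)
  have contr: "continuous_on UNIV (\<lambda>r. F (c t + r *\<^sub>R d t))" for t
    by (intro continuous_intros continuous_on_compose2[OF F]) auto
  have "closed (Z t)" for t
    unfolding Z_def using contr by (intro closed_Collect_eq) auto
  have near: "\<forall>\<^sub>F t in nhds t0. \<exists>x\<in>Z t. \<bar>x - r0\<bar> < e" if "e > 0" for e
  proof -
    obtain d1 where d1: "d1 > 0" "\<And>h. 0 < h \<Longrightarrow> h < d1 \<Longrightarrow> F (c t0 + r0 *\<^sub>R d t0) < F (c t0 + (r0 + h) *\<^sub>R d t0)"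
      using DERIV_pos_inc_right[OF der \<open>0 < D\<close>] by blast
    obtain d2 where d2: "d2 > 0" "\<And>h. 0 < h \<Longrightarrow> h < d2 \<Longrightarrow> F (c t0 + (r0 - h) *\<^sub>R d t0) < F (c t0 + r0 *\<^sub>R d t0)"
      using DERIV_pos_inc_left[OF der \<open>0 < D\<close>] by blast
    define h where "h = min e (min d1 d2) / 2"
    have h: "0 < h" "h < e" "h < d1" "h < d2"
      using \<open>e > 0\<close> d1(1) d2(1) by (auto simp: h_def)
    have "isCont (\<lambda>t. F (c t + x *\<^sub>R d t)) t0" for x
      by (rule isCont_o2[OF _ contF]) (intro continuous_intros c d)
    then have cont: "((\<lambda>t. F (c t + x *\<^sub>R d t)) \<longlongrightarrow> F (c t0 + x *\<^sub>R d t0)) (nhds t0)" for x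
      unfolding isCont_iff_tendsto_nhds .
    have "\<forall>\<^sub>F t in nhds t0. F (c t + (r0 + h) *\<^sub>R d t) > 0"
      using order_tendstoD(1)[OF cont] d1(2)[of h] h zero
      by simp
    moreover have "\<forall>\<^sub>F t in nhds t0. F (c t + (r0 - h) *\<^sub>R d t) < 0"
      using order_tendstoD(2)[OF cont] d2(2)[of h] h zero
      by simp
    ultimately show ?thesis
    proof eventually_elim
      case (elim t)
      have "\<exists>x. r0 - h \<le> x \<and> x \<le> r0 + h \<and> F (c t + x *\<^sub>R d t) = 0"
        by (rule IVT') (use elim h in \<open>auto intro: continuous_on_subset[OF contr]\<close>)
      then show ?case
        using h by (auto simp: Z_def intro!: bexI)
    qed
  qed
  have r_near: "dist r0 (r t) \<le> \<bar>x - r0\<bar>" if "x \<in> Z t" for x t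
    using closest_point_le[OF \<open>closed (Z t)\<close> that, of r0] by (simp add: r_def dist_real_def abs_minus_commute)
  have "(r \<longlongrightarrow> r0) (nhds t0)"
  proof (rule tendstoI)
    fix e :: real assume "0 < e"
    from near[OF this] show "\<forall>\<^sub>F t in nhds t0. dist (r t) r0 < e"
      by eventually_elim (use r_near in \<open>fastforce simp: dist_commute\<close>)
  qed
  moreover have "r t0 = r0"
    unfolding r_def by (rule closest_point_self) (simp add: Z_def zero)
  moreover have "\<forall>\<^sub>F t in nhds t0. F (c t + r t *\<^sub>R d t) = 0"
    using near[OF zero_less_one]
  proof eventually_elim
    case (elim t)
    then have "r t \<in> Z t"
      unfolding r_def by (intro closest_point_in_set \<open>closed (Z t)\<close>) auto
    then show ?case by (simp add: Z_def)
  qed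
  ultimately show ?thesis
    by (intro exI[of _ r]) (auto simp: isCont_iff_tendsto_nhds)
qed

lemma has_vector_derivative_imp_tendsto:
  assumes "(f has_vector_derivative D) (at t0)"
  shows "((\<lambda>t. (f t - f t0) /\<^sub>R (t - t0)) \<longlongrightarrow> D) (at t0)"
proof -
  have "((\<lambda>t. norm ((f t - f t0) - (t - t0) *\<^sub>R D) / norm (t - t0)) \<longlongrightarrow> 0) (at t0)"
    using assms by (simp add: has_vector_derivative_def has_derivative_iff_norm)
  then have "((\<lambda>t. norm ((f t - f t0) /\<^sub>R (t - t0) - D)) \<longlongrightarrow> 0) (at t0)"
  proof (rule tendsto_cong[THEN iffD1, rotated])
    have "norm ((f t - f t0) - (t - t0) *\<^sub>R D) / norm (t - t0) = norm ((f t - f t0) /\<^sub>R (t - t0) - D)"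
      if "t \<noteq> t0" for t
    proof -
      have "(f t - f t0) /\<^sub>R (t - t0) - D = ((f t - f t0) - (t - t0) *\<^sub>R D) /\<^sub>R (t - t0)"
        using that by (simp add: scaleR_diff_right)
      then show ?thesis by (simp add: divide_inverse mult.commute)
    qed
    then show "\<forall>\<^sub>F t in at t0. norm ((f t - f t0) - (t - t0) *\<^sub>R D) / norm (t - t0)
        = norm ((f t - f t0) /\<^sub>R (t - t0) - D)"
      by (auto simp: eventually_at_filter)
  qed
  then show ?thesis
    by (simp add: LIM_zero_iff tendsto_norm_zero_iff)
qed

text \<open>The remainder \<open>e y\<close> is spread along \<open>y - q\<close>, so that an
  increment of \<open>F\<close> becomes an exact inner product with a vector continuous at
  \<open>q\<close>. An equation between values of \<open>F\<close> can then be solved like a linear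
  one.\<close>

lemma caratheodory_gradient:
  fixes F :: "'a::real_inner \<Rightarrow> real"
  assumes "(F has_derivative (\<lambda>h. h \<bullet> g)) (at q)"
  shows "\<exists>H. (\<forall>y. F y - F q = (y - q) \<bullet> H y) \<and> H q = g \<and> isCont H q"
proof -
  define e where "e y = F y - F q - (y - q) \<bullet> g" for y
  \<comment> \<open>At \<open>y = q\<close> the quotient is a division by zero with value
    \<open>0\<close>, which gives \<open>H q = g\<close>.\<close>
  define H where "H y = g + (e y / (norm (y - q))\<^sup>2) *\<^sub>R (y - q)" for y
  have "F y - F q = (y - q) \<bullet> H y" for y
    by (simp add: H_def e_def inner_add_right power2_norm_eq_inner)
  moreover have "H q = g" by (simp add: H_def)
  moreover have "isCont H q"
  proof -
    have "((\<lambda>y. norm (e y) / norm (y - q)) \<longlongrightarrow> 0) (at q)"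
      using assms by (simp add: e_def has_derivative_iff_norm)
    moreover have "norm (e y) / norm (y - q) = norm (H y - g)" for y
      by (simp add: H_def power2_eq_square)
    ultimately have "((\<lambda>y. H y - g) \<longlongrightarrow> 0) (at q)"
      by (simp add: tendsto_norm_zero_iff)
    then show ?thesis
      by (simp add: isCont_def \<open>H q = g\<close> LIM_zero_iff)
  qed
  ultimately show ?thesis by blast
qed

text \<open>Implicit differentiation. With the vector \<open>H\<close> from
  \<open>caratheodory_gradient\<close>, vanishing of \<open>F\<close> along the path is a linear
  equation for \<open>r t - r t0\<close>; dividing by \<open>t - t0\<close> and passing to the limit
  upgrades continuity of \<open>r\<close> to differentiability.\<close>

lemma zero_path_has_derivative:
  fixes F :: "'a::real_inner \<Rightarrow> real" and c d :: "real \<Rightarrow> 'a"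
  assumes F: "(F has_derivative (\<lambda>h. h \<bullet> g)) (at (c t0 + r t0 *\<^sub>R d t0))"
    and r: "isCont r t0"
    and c: "(c has_vector_derivative c') (at t0)"
    and d: "(d has_vector_derivative d') (at t0)"
    and zero: "\<forall>\<^sub>F t in nhds t0. F (c t + r t *\<^sub>R d t) = 0"
    and ne: "d t0 \<bullet> g \<noteq> 0"
  shows "(r has_real_derivative - ((c' + r t0 *\<^sub>R d') \<bullet> g) / (d t0 \<bullet> g)) (at t0)"
proof -
  define q where "q t = c t + r t *\<^sub>R d t" for t
  \<comment> \<open>\<open>A\<close> freezes the parameter at \<open>r t0\<close>, so that the whole
    change of \<open>r\<close> sits in the single term
    \<open>(r t - r t0) *\<^sub>R d t\<close>.\<close>
  define A where "A t = c t + r t0 *\<^sub>R d t" for t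
  have "(F has_derivative (\<lambda>h. h \<bullet> g)) (at (q t0))"
    using F by (simp add: q_def)
  from caratheodory_gradient[OF this] obtain H where H: "\<And>y. F y - F (q t0) = (y - q t0) \<bullet> H y"
    "H (q t0) = g" "isCont H (q t0)"
    by blast
  have cd: "isCont c t0" "isCont d t0"
    using c d has_vector_derivative_continuous by blast+
  have "isCont q t0"
    unfolding q_def by (intro continuous_intros cd r)
  then have "isCont (\<lambda>t. H (q t)) t0"
    by (rule isCont_o2) (rule H(3))
  then have Hq: "((\<lambda>t. H (q t)) \<longlongrightarrow> g) (at t0)"
    using H(2) by (simp add: isCont_def)
  have dq: "((\<lambda>t. d t \<bullet> H (q t)) \<longlongrightarrow> d t0 \<bullet> g) (at t0)"
    using cd(2) by (intro tendsto_intros Hq) (simp add: isCont_def)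
  have "(A has_vector_derivative c' + r t0 *\<^sub>R d') (at t0)"
    unfolding A_def by (auto intro!: derivative_eq_intros c d)
  from has_vector_derivative_imp_tendsto[OF this]
  have lim: "((\<lambda>t. - (((A t - A t0) /\<^sub>R (t - t0)) \<bullet> H (q t)) / (d t \<bullet> H (q t)))
      \<longlongrightarrow> - ((c' + r t0 *\<^sub>R d') \<bullet> g) / (d t0 \<bullet> g)) (at t0)"
    by (intro tendsto_intros Hq dq ne)
  have "F (q t0) = 0"
    using eventually_nhds_x_imp_x[OF zero] by (simp add: q_def)
  have "\<forall>\<^sub>F t in at t0. F (q t) = 0"
    using zero by (auto simp: q_def eventually_at_filter elim: eventually_mono)
  moreover have "\<forall>\<^sub>F t in at t0. d t \<bullet> H (q t) \<noteq> 0"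
    using tendsto_imp_eventually_ne[OF dq ne] .
  moreover have "\<forall>\<^sub>F t in at t0. t \<noteq> t0"
    by (simp add: eventually_at_filter)
  ultimately have "\<forall>\<^sub>F t in at t0. - (((A t - A t0) /\<^sub>R (t - t0)) \<bullet> H (q t)) / (d t \<bullet> H (q t))
      = (r t - r t0) / (t - t0)"
  proof eventually_elim
    case (elim t)
    have "q t - q t0 = (A t - A t0) + (r t - r t0) *\<^sub>R d t"
      by (simp add: q_def A_def algebra_simps)
    then have "(A t - A t0) \<bullet> H (q t) + (r t - r t0) * (d t \<bullet> H (q t)) = 0"
      using H(1)[of "q t"] elim(1) \<open>F (q t0) = 0\<close> by (simp add: inner_add_left)
    then have "- ((A t - A t0) \<bullet> H (q t)) / (d t \<bullet> H (q t)) = r t - r t0"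
      using elim(2) by (simp add: field_simps)
    then show ?case
      by (metis (no_types, lifting) divide_divide_eq_left divide_inverse inner_scaleR_left mult.commute
          mult_minus_right)
  qed
  from tendsto_cong[THEN iffD1, OF this lim] show ?thesis
    by (simp add: has_field_derivative_iff)
qed

section \<open>The inner normal and its shape operator\<close>

lemma has_derivative_grad:
  fixes F :: "'a::euclidean_space \<Rightarrow> real"
  assumes "Ck_on (Suc m) UNIV F"
  shows "(F has_derivative (\<lambda>h. h \<bullet> grad F x)) (at x)"
proof -
  have D: "(F has_derivative frechet_derivative F (at x)) (at x)"
    by (rule Ck_on_Suc_has_derivative[OF assms])
  then have lin: "linear (frechet_derivative F (at x))"
    by (rule has_derivative_linear)
  have "frechet_derivative F (at x) h = h \<bullet> grad F x" for h
  proof -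
    have "frechet_derivative F (at x) h = frechet_derivative F (at x) (\<Sum>i\<in>Basis. (h \<bullet> i) *\<^sub>R i)"
      by (simp add: euclidean_representation)
    also have "\<dots> = h \<bullet> grad F x"
      by (simp add: grad_def linear_sum[OF lin] linear_cmul[OF lin] inner_sum_right mult.commute)
    finally show ?thesis .
  qed
  then show ?thesis using D by (metis (no_types, lifting) ext)
qed

text \<open>\<open>G\<close> is the Hessian as a linear map: its pairings are mixed second
  derivatives, and these commute.\<close>

lemma grad_has_derivative_symmetric:
  fixes F :: "'a::euclidean_space \<Rightarrow> real"
  assumes F: "Ck_on (Suc (Suc 0)) UNIV F"
  shows "\<exists>G. (grad F has_derivative G) (at x) \<and> (\<forall>h k. G h \<bullet> k = G k \<bullet> h)"
proof -
  define D where "D h k = frechet_derivative (\<lambda>y. frechet_derivative F (at y) h) (at x) k" for h k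
  have D: "((\<lambda>y. frechet_derivative F (at y) h) has_derivative D h) (at x)" for h
    unfolding D_def by (rule Ck_on_Suc_has_derivative[of 0]) (use F in simp)
  have sym: "D h k = D k h" for h k
    unfolding D_def by (rule second_derivative_symmetric[OF F])
  define G where "G h = (\<Sum>i\<in>Basis. D i h *\<^sub>R i)" for h
  have "(grad F has_derivative G) (at x)"
    unfolding grad_def[abs_def] G_def[abs_def] by (intro has_derivative_sum has_derivative_scaleR_left D)
  moreover have G: "G h \<bullet> k = D h k" for h k
  proof -
    have lin: "linear (D h)" using D by (rule has_derivative_linear)
    have "D h k = D h (\<Sum>i\<in>Basis. (k \<bullet> i) *\<^sub>R i)"
      by (simp add: euclidean_representation)
    also have "\<dots> = (\<Sum>i\<in>Basis. (k \<bullet> i) * D h i)"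
      by (simp add: linear_sum[OF lin] linear_cmul[OF lin])
    also have "\<dots> = G h \<bullet> k"
      unfolding G_def inner_sum_left by (intro sum.cong) (simp_all add: sym[of h] inner_commute)
    finally show ?thesis by simp
  qed
  ultimately show ?thesis using sym by (intro exI[of _ G]) (auto simp: G)
qed

lemma norm_inner_normal:
  assumes "grad F p \<noteq> 0"
  shows "norm (inner_normal F p) = 1"
  using assms by (simp add: inner_normal_def)

lemma inner_inner_normal:
  assumes "grad F p \<noteq> 0"
  shows "x \<bullet> grad F p = - norm (grad F p) * (x \<bullet> inner_normal F p)"
  using assms by (simp add: inner_normal_def)

text \<open>Up to sign this is the shape operator. Normalising adds to the rescaled Hessian only a
  multiple of the gradient, which makes the values tangent and disappears when paired with tangent
  vectors. Symmetry of the Hessian therefore gives self-adjointness on the tangent space.\<close>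

lemma inner_normal_has_derivative_symmetric:
  fixes F :: "'a::euclidean_space \<Rightarrow> real"
  assumes F: "Ck_on (Suc (Suc 0)) UNIV F" and ne: "grad F p \<noteq> 0"
  shows "\<exists>W. (inner_normal F has_derivative W) (at p) \<and> (\<forall>x. W x \<bullet> inner_normal F p = 0) \<and>
    (\<forall>x y. x \<bullet> inner_normal F p = 0 \<longrightarrow> y \<bullet> inner_normal F p = 0 \<longrightarrow> W x \<bullet> y = W y \<bullet> x)"
proof -
  obtain G where G: "(grad F has_derivative G) (at p)" "\<And>h k. G h \<bullet> k = G k \<bullet> h"
    using grad_has_derivative_symmetric[OF F] by blast
  let ?g = "grad F p"
  define W where "W x = - ((1 / norm ?g) *\<^sub>R G x + (- (G x \<bullet> sgn ?g) / (norm ?g * norm ?g)) *\<^sub>R ?g)" for x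
  have "((\<lambda>y. norm (grad F y)) has_derivative (\<lambda>x. G x \<bullet> sgn ?g)) (at p)"
    using has_derivative_compose[OF G(1) has_derivative_norm[OF ne]] by simp
  then have "((\<lambda>y. - ((1 / norm (grad F y)) *\<^sub>R grad F y)) has_derivative W) (at p)"
    unfolding W_def[abs_def] using ne
    by (auto intro!: derivative_eq_intros G(1) simp: fun_eq_iff)
  then have "(inner_normal F has_derivative W) (at p)"
    by (simp add: inner_normal_def[abs_def])
  moreover have "W x \<bullet> inner_normal F p = 0" for x
  proof -
    have "W x \<bullet> ?g = 0"
      using ne by (simp add: W_def inner_diff_left inner_add_left sgn_div_norm power2_norm_eq_inner[symmetric] power2_eq_square)
        (simp add: divide_inverse)
    then show ?thesis by (simp add: inner_normal_def)
  qed
  moreover have "W x \<bullet> y = W y \<bullet> x" if "x \<bullet> inner_normal F p = 0" "y \<bullet> inner_normal F p = 0" for x y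
  proof -
    have "?g \<bullet> x = 0" "?g \<bullet> y = 0"
      using that inner_inner_normal[OF ne] by (simp_all add: inner_commute)
    then show ?thesis
      using G(2)[of x y] by (simp add: W_def inner_diff_left)
  qed
  ultimately show ?thesis by blast
qed

section \<open>Chords of a Gutkin table\<close>

lemma has_vector_derivative_inner:
  fixes f g :: "real \<Rightarrow> 'a::real_inner"
  assumes "(f has_vector_derivative f') (at t)" "(g has_vector_derivative g') (at t)"
  shows "((\<lambda>t. f t \<bullet> g t) has_vector_derivative f t \<bullet> g' + f' \<bullet> g t) (at t)"
  using bounded_bilinear.has_vector_derivative[OF bounded_bilinear_inner assms] .

lemma has_vector_derivative_eventually_const:
  assumes "(f has_vector_derivative D) (at t0)" "\<forall>\<^sub>F t in nhds t0. f t = c"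
  shows "D = 0"
proof -
  have "((\<lambda>_. c) has_vector_derivative D) (at t0)"
  proof (rule has_vector_derivative_cong_ev[THEN iffD1, OF _ _ assms(1)])
    show "\<forall>\<^sub>F t in nhds t0. t \<in> UNIV \<longrightarrow> f t = c"
      using assms(2) by simp
    show "f t0 = c"
      by (rule eventually_nhds_x_imp_x[OF assms(2)])
  qed
  then show ?thesis
    using vector_derivative_unique_at has_vector_derivative_const by blast
qed

lemma has_vector_derivative_compose:
  assumes "(g has_vector_derivative g') (at t)" "(f has_derivative f') (at (g t))"
  shows "((\<lambda>t. f (g t)) has_vector_derivative f' g') (at t)"
proof -
  have "linear f'" using assms(2) by (rule has_derivative_linear)
  then show ?thesis
    using has_derivative_compose[OF assms(1)[unfolded has_vector_derivative_def] assms(2)]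
    by (simp add: has_vector_derivative_def linear_cmul)
qed

text \<open>A Lagrange multiplier argument. In the application \<open>n\<close> is the entry normal,
  \<open>m\<close> its derivative along \<open>v\<close>, \<open>N\<close> the exit normal, and
  \<open>X\<close> combines \<open>N\<close> with its derivative. By \<open>var\<close> one
  functional of \<open>\<xi>\<close> and \<open>\<zeta>\<close> vanishes on the kernel of the
  linearised entry-angle condition, so it is a multiple of that condition, with factor
  \<open>- L * \<rho>\<close>. The coefficient of \<open>\<zeta>\<close> then determines
  \<open>X\<close>, that of \<open>\<xi>\<close> determines \<open>N\<close>.\<close>

lemma exit_frame_algebra:
  fixes v n m N X z :: "'a::real_inner" and s c L :: real
  assumes vn: "v \<bullet> v = 1" "n \<bullet> n = 1" "v \<bullet> n = 0" and m: "m \<bullet> n = 0"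
    and sc: "0 < s" "0 < c" "s * s + c * c = 1" and "0 < L"
    and z: "z = c *\<^sub>R v + s *\<^sub>R n" and Nz: "N \<bullet> z = - s" and Xz: "X \<bullet> z = - s"
    and var: "\<And>\<xi> \<zeta>. \<xi> \<bullet> n = 0 \<Longrightarrow> \<zeta> \<bullet> z = 0 \<Longrightarrow> \<zeta> \<bullet> n + c * (m \<bullet> \<xi>) = 0 \<Longrightarrow>
      L * (\<zeta> \<bullet> X) + \<xi> \<bullet> (X - N) = 0"
  shows "\<exists>\<rho>. X = - (s *\<^sub>R z) - \<rho> *\<^sub>R (n - s *\<^sub>R z) \<and>
    N = - (s *\<^sub>R z) + (\<rho> * c / s) *\<^sub>R (v - c *\<^sub>R z + L *\<^sub>R (s *\<^sub>R m - (c * (v \<bullet> m)) *\<^sub>R n))"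
proof -
  have nv: "n \<bullet> v = 0" using vn by (simp add: inner_commute)
  \<comment> \<open>The part of \<open>X\<close> orthogonal to \<open>v\<close> and
    \<open>n\<close>, taken with zero displacement of the base point, is an admissible variation;
    \<open>var\<close> says that its square is zero.\<close>
  define \<zeta> where "\<zeta> = X - (X \<bullet> v) *\<^sub>R v - (X \<bullet> n) *\<^sub>R n"
  have "\<zeta> \<bullet> v = 0" "\<zeta> \<bullet> n = 0"
    by (simp_all add: \<zeta>_def inner_diff_left vn nv)
  moreover from this have "L * (\<zeta> \<bullet> X) + 0 \<bullet> (X - N) = 0"
    by (intro var) (simp_all add: z inner_add_right)
  ultimately have "\<zeta> \<bullet> (X - (X \<bullet> v) *\<^sub>R v - (X \<bullet> n) *\<^sub>R n) = 0"
    using \<open>0 < L\<close> by (simp add: inner_diff_right)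
  then have "\<zeta> = 0"
    unfolding \<zeta>_def[symmetric] by simp
  then have X: "X = (X \<bullet> v) *\<^sub>R v + (X \<bullet> n) *\<^sub>R n"
    by (simp add: \<zeta>_def algebra_simps)
  \<comment> \<open>Chosen so that both sides of the claimed formula for \<open>X\<close> have the
    same product with \<open>n\<close>, because \<open>n - s *\<^sub>R z\<close> pairs with
    \<open>n\<close> to \<open>c * c\<close>. The product with \<open>z\<close> is prescribed by
    \<open>Xz\<close>.\<close>
  define \<rho> where "\<rho> = - (X \<bullet> n + s * s) / (c * c)"
  have Xn: "X \<bullet> n = - (s * s) - \<rho> * (c * c)"
    using sc by (simp add: \<rho>_def)
  have "c * (X \<bullet> v) + s * (X \<bullet> n) = - s"
    using Xz by (simp add: z inner_add_right)
  then have "c * (X \<bullet> v) = c * (- (s * c) + \<rho> * (s * c))"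
    using sc(3) unfolding Xn by algebra
  then have Xv: "X \<bullet> v = - (s * c) + \<rho> * (s * c)"
    using sc(2) by simp
  have ns: "n - s *\<^sub>R z = (c * c) *\<^sub>R n - (s * c) *\<^sub>R v"
  proof -
    have "n - s *\<^sub>R z = (s * s + c * c) *\<^sub>R n - s *\<^sub>R z"
      by (simp add: sc(3))
    also have "\<dots> = (c * c) *\<^sub>R n - (s * c) *\<^sub>R v"
      by (simp add: z scaleR_add_left scaleR_add_right)
    finally show ?thesis .
  qed
  have X1: "X = - (s *\<^sub>R z) - \<rho> *\<^sub>R (n - s *\<^sub>R z)"
    unfolding ns by (subst X) (simp add: Xn Xv z algebra_simps)
  \<comment> \<open>\<open>T\<close> is the coefficient of \<open>\<xi>\<close> that remains once
    the multiplier is taken off. It annihilates all vectors orthogonal to \<open>n\<close>, hence is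
    a multiple of \<open>n\<close>.\<close>
  define T where "T = (L * \<rho> * c) *\<^sub>R m + (X - N)"
  have perp: "\<xi> \<bullet> T = 0" if "\<xi> \<bullet> n = 0" for \<xi>
  proof -
    \<comment> \<open>The change of direction that compensates the displacement \<open>\<xi>\<close>
      in the entry-angle condition. It points along the part of \<open>n\<close> orthogonal to
      \<open>z\<close>.\<close>
    define \<eta> where "\<eta> = (- (m \<bullet> \<xi>) / c) *\<^sub>R (n - s *\<^sub>R z)"
    have nz: "(n - s *\<^sub>R z) \<bullet> z = 0"
      unfolding ns using sc by (simp add: z inner_diff_left inner_add_right vn nv)
    have nn: "(n - s *\<^sub>R z) \<bullet> n = c * c"
      unfolding ns by (simp add: inner_diff_left vn)
    have "(n - s *\<^sub>R z) \<bullet> X = X \<bullet> n - s * (X \<bullet> z)"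
      by (simp add: inner_diff_left inner_commute[of X])
    then have nX: "(n - s *\<^sub>R z) \<bullet> X = - \<rho> * (c * c)"
      by (simp add: Xn Xz)
    have "L * (\<eta> \<bullet> X) + \<xi> \<bullet> (X - N) = 0"
      using sc that by (intro var) (simp_all add: \<eta>_def nz nn)
    moreover have "\<eta> \<bullet> X = \<rho> * c * (m \<bullet> \<xi>)"
      using sc by (simp add: \<eta>_def nX)
    ultimately show ?thesis
      by (simp add: T_def inner_add_right inner_commute[of m])
  qed
  have "(T - (T \<bullet> n) *\<^sub>R n) \<bullet> n = 0"
    by (simp add: inner_diff_left vn)
  then have "(T - (T \<bullet> n) *\<^sub>R n) \<bullet> (T - (T \<bullet> n) *\<^sub>R n) = 0"
    using perp by (simp add: inner_diff_right)
  then have T: "T = (T \<bullet> n) *\<^sub>R n"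
    by simp
  have "n \<bullet> z = s" by (simp add: z inner_add_right vn nv)
  then have "T \<bullet> z = (T \<bullet> n) * s"
    by (subst T) simp
  \<comment> \<open>Pairing with \<open>z\<close> finds the factor of \<open>n\<close> in
    \<open>T\<close>: the contributions of \<open>X\<close> and \<open>N\<close> cancel because both
    pair with \<open>z\<close> to \<open>- s\<close>.\<close>
  moreover have "T \<bullet> z = L * \<rho> * c * (c * (v \<bullet> m))"
    using m by (simp add: T_def inner_add_left inner_diff_left Nz Xz) (simp add: z inner_add_right inner_commute)
  ultimately have Tn: "T \<bullet> n = (L * \<rho> * c) * (c * (v \<bullet> m)) / s"
    using sc by (simp add: field_simps)
  have "N = X + (L * \<rho> * c) *\<^sub>R m - T"
    by (simp add: T_def)
  also have "\<dots> = X + (L * \<rho> * c) *\<^sub>R m - ((L * \<rho> * c) * (c * (v \<bullet> m)) / s) *\<^sub>R n"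
    by (subst T) (simp add: Tn)
  also have "\<dots> = X + (\<rho> * c / s) *\<^sub>R (L *\<^sub>R (s *\<^sub>R m - (c * (v \<bullet> m)) *\<^sub>R n))"
    using sc by (simp add: scaleR_diff_right ac_simps)
  also have "X = - (s *\<^sub>R z) + (\<rho> * c / s) *\<^sub>R (v - c *\<^sub>R z)"
  proof -
    have vz: "v - c *\<^sub>R z = (s * s) *\<^sub>R v - (s * c) *\<^sub>R n"
    proof -
      have "v - c *\<^sub>R z = (s * s + c * c) *\<^sub>R v - c *\<^sub>R z"
        by (simp add: sc(3))
      also have "\<dots> = (s * s) *\<^sub>R v - (s * c) *\<^sub>R n"
        by (simp add: z scaleR_add_left scaleR_add_right mult.commute)
      finally show ?thesis .
    qed
    have "(\<rho> * c / s) *\<^sub>R (v - c *\<^sub>R z) = - (\<rho> *\<^sub>R (n - s *\<^sub>R z))"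
      unfolding ns vz using sc by (simp add: scaleR_diff_right ac_simps)
    then show ?thesis by (subst X1) simp
  qed
  finally have "N = - (s *\<^sub>R z) + (\<rho> * c / s) *\<^sub>R (v - c *\<^sub>R z + L *\<^sub>R (s *\<^sub>R m - (c * (v \<bullet> m)) *\<^sub>R n))"
    by (simp add: scaleR_add_right add.assoc)
  with X1 show ?thesis by blast
qed

locale gutkin =
  fixes F :: "'a::euclidean_space \<Rightarrow> real" and \<delta> :: real
  assumes delta: "0 < \<delta>" "\<delta> < pi / 2"
    and table: "gutkin_table F \<delta>"
begin

abbreviation nu :: "'a \<Rightarrow> 'a" where "nu \<equiv> inner_normal F"

lemma sin_delta_pos: "sin \<delta> > 0" and cos_delta_pos: "cos \<delta> > 0"
  using delta by (auto intro!: sin_gt_zero cos_gt_zero)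

lemma Ck_F: "Ck_on m UNIV F"
  using table by (simp add: gutkin_table_def smooth_convex_hypersurface_def smooth_map_on_def)

lemma grad_nonzero: "F p = 0 \<Longrightarrow> grad F p \<noteq> 0"
  using table by (simp add: gutkin_table_def smooth_convex_hypersurface_def)

lemma norm_nu: "F p = 0 \<Longrightarrow> norm (nu p) = 1"
  by (simp add: norm_inner_normal grad_nonzero)

lemma F_has_derivative: "(F has_derivative (\<lambda>h. h \<bullet> grad F x)) (at x)"
  by (rule has_derivative_grad[OF Ck_F])

lemma F_continuous: "continuous_on UNIV F"
  using Ck_F[of 0] by simp

lemma F_along_line: "((\<lambda>r. F (p + r *\<^sub>R z)) has_real_derivative z \<bullet> grad F (p + r *\<^sub>R z)) (at r)"
  using has_derivative_along_line[OF F_has_derivative] .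

section \<open>Convexity and the exit of a chord\<close>

lemma domain_segment:
  assumes "F p \<le> 0" "F (p + L *\<^sub>R z) \<le> 0" "0 \<le> r" "r \<le> L"
  shows "F (p + r *\<^sub>R z) \<le> 0"
proof (cases "L = 0")
  case False
  have "convex {x. F x \<le> 0}"
    using table by (simp add: gutkin_table_def smooth_convex_hypersurface_def)
  then have "(1 - r / L) *\<^sub>R p + (r / L) *\<^sub>R (p + L *\<^sub>R z) \<in> {x. F x \<le> 0}"
    by (rule convexD) (use assms False in \<open>auto simp: field_simps\<close>)
  moreover have "(1 - r / L) *\<^sub>R p + (r / L) *\<^sub>R (p + L *\<^sub>R z) = p + r *\<^sub>R z"
    using False by (simp add: algebra_simps)
  ultimately show ?thesis by simp
qed (use assms in auto)

text \<open>If \<open>z\<close> pointed strictly inwards at the exit point, \<open>F\<close> would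
  be positive just before it, although the chord stays in the convex domain.\<close>

lemma exit_inner_normal_nonpos:
  assumes "F p = 0" "F (p + L *\<^sub>R z) = 0" "0 < L"
  shows "z \<bullet> nu (p + L *\<^sub>R z) \<le> 0"
proof (rule ccontr)
  assume "\<not> ?thesis"
  then have "z \<bullet> grad F (p + L *\<^sub>R z) < 0"
    using inner_inner_normal[OF grad_nonzero[OF assms(2)], of z] grad_nonzero[OF assms(2)]
    by (simp add: mult_pos_pos)
  from DERIV_neg_dec_left[OF F_along_line this] obtain d where d: "d > 0"
    "\<And>h. 0 < h \<Longrightarrow> h < d \<Longrightarrow> F (p + L *\<^sub>R z) < F (p + (L - h) *\<^sub>R z)"
    by blast
  define h where "h = min d L / 2"
  have "0 < h" "h < d" "h \<le> L"
    using d(1) assms(3) by (auto simp: h_def)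
  then show False
    using d(2)[of h] domain_segment[of p L z "L - h"] assms by simp
qed

text \<open>The Gutkin property controls only the unoriented angle, that is
  \<open>\<bar>z \<bullet> nu q\<bar>\<close> at the exit point \<open>q\<close>; convexity fixes
  the sign.\<close>

lemma chord_exit_angle:
  assumes p: "F p = 0" and q: "F (p + L *\<^sub>R z) = 0" and "0 < L"
    and z: "norm z = 1" "z \<bullet> nu p = sin \<delta>"
  shows "z \<bullet> nu (p + L *\<^sub>R z) = - sin \<delta>"
proof -
  let ?q = "p + L *\<^sub>R z"
  have ang: "angle_to_tangent F x (?q - p) = arcsin \<bar>z \<bullet> nu x\<bar>" if "F x = 0" for x
    using grad_nonzero[OF that] \<open>0 < L\<close> z(1)
    by (simp add: angle_to_tangent_def inner_inner_normal[OF grad_nonzero[OF that]] abs_mult)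
  have "arcsin \<bar>z \<bullet> nu p\<bar> = \<delta>"
    using z(2) sin_delta_pos delta by (simp add: arcsin_sin)
  moreover have "p \<noteq> ?q" using \<open>0 < L\<close> z(1) by auto
  ultimately have "arcsin \<bar>z \<bullet> nu ?q\<bar> = \<delta>"
    using table p q ang unfolding gutkin_table_def by metis
  moreover have "\<bar>z \<bullet> nu ?q\<bar> \<le> 1"
    using Cauchy_Schwarz_ineq2[of z "nu ?q"] z(1) norm_nu[OF q] by simp
  ultimately have "\<bar>z \<bullet> nu ?q\<bar> = sin \<delta>"
    using sin_arcsin[of "\<bar>z \<bullet> nu ?q\<bar>"] by simp
  then show ?thesis
    using exit_inner_normal_nonpos[OF p q \<open>0 < L\<close>] by simp
qed

lemma exit_grad_pos:
  assumes "F p = 0" "F (p + L *\<^sub>R z) = 0" "0 < L" "norm z = 1" "z \<bullet> nu p = sin \<delta>"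
  shows "z \<bullet> grad F (p + L *\<^sub>R z) > 0"
  using inner_inner_normal[OF grad_nonzero[OF assms(2)], of z] chord_exit_angle[OF assms]
    grad_nonzero[OF assms(2)] sin_delta_pos by simp

text \<open>The exit is transversal, so \<open>F\<close> is positive just beyond the shorter chord,
  whereas convexity keeps it nonpositive up to the end of the longer one.\<close>

lemma chord_length_unique:
  assumes p: "F p = 0" and z: "norm z = 1" "z \<bullet> nu p = sin \<delta>"
    and L: "F (p + L *\<^sub>R z) = 0" "0 < L" and M: "F (p + M *\<^sub>R z) = 0" "0 < M"
  shows "L = M"
proof -
  have no: False if LM: "F (p + L *\<^sub>R z) = 0" "0 < L" "F (p + M *\<^sub>R z) = 0" "L < M" for L M
  proof -
    obtain d where d: "d > 0"
      "\<And>h. 0 < h \<Longrightarrow> h < d \<Longrightarrow> F (p + L *\<^sub>R z) < F (p + (L + h) *\<^sub>R z)"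
      using DERIV_pos_inc_right[OF F_along_line exit_grad_pos[OF p LM(1,2) z]] by blast
    define h where "h = min d (M - L) / 2"
    have "0 < h" "h < d"
      using d(1) LM by (auto simp: h_def)
    moreover have "2 * h \<le> M - L"
      by (simp add: h_def)
    then have "L + h \<le> M"
      using LM by linarith
    ultimately show False
      using d(2)[of h] domain_segment[of p M z "L + h"] LM p by simp
  qed
  show ?thesis
    using no[OF L M(1)] no[OF M L(1)] by fastforce
qed

text \<open>The transversality \<open>pos\<close> serves twice: it gives a selection of the zero
  that is continuous at \<open>t0\<close>, and then the derivative of that selection.\<close>

lemma chord_selection_differentiable:
  fixes c z :: "real \<Rightarrow> 'a"
  assumes c: "(c has_vector_derivative c') (at t0)" and z: "(z has_vector_derivative z') (at t0)"
    and zero: "F (c t0 + r0 *\<^sub>R z t0) = 0" and pos: "z t0 \<bullet> grad F (c t0 + r0 *\<^sub>R z t0) > 0"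
  shows "\<exists>r r'. r t0 = r0 \<and> (r has_real_derivative r') (at t0) \<and>
    (\<forall>\<^sub>F t in nhds t0. F (c t + r t *\<^sub>R z t) = 0)"
proof -
  have "isCont c t0" "isCont z t0"
    using c z has_vector_derivative_continuous by blast+
  then obtain r where r: "r t0 = r0" "isCont r t0" "\<forall>\<^sub>F t in nhds t0. F (c t + r t *\<^sub>R z t) = 0"
    using continuous_zero_selection[where c = c and d = z, OF F_continuous _ _ zero F_along_line pos]
    by blast
  then show ?thesis
    using zero_path_has_derivative[OF F_has_derivative r(2) c z r(3)] pos by fastforce
qed

text \<open>Near \<open>t0\<close> the selected zero is positive, so by uniqueness of the chord
  length it coincides with \<open>l\<close> and passes its derivative on to it.\<close>

lemma chord_length_differentiable:
  fixes c z :: "real \<Rightarrow> 'a"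
  assumes c: "\<And>t. F (c t) = 0" "\<And>t. (c has_vector_derivative c' t) (at t)"
    and z: "\<And>t. norm (z t) = 1" "\<And>t. z t \<bullet> nu (c t) = sin \<delta>" "\<And>t. (z has_vector_derivative z' t) (at t)"
    and l: "\<And>t. 0 < l t" "\<And>t. F (c t + l t *\<^sub>R z t) = 0"
  shows "\<exists>l'. (l has_real_derivative l') (at t0)"
proof -
  have "z t0 \<bullet> grad F (c t0 + l t0 *\<^sub>R z t0) > 0"
    using exit_grad_pos c z l by blast
  from chord_selection_differentiable[OF c(2) z(3) l(2) this]
  obtain r r' where r: "r t0 = l t0" "(r has_real_derivative r') (at t0)"
    "\<forall>\<^sub>F t in nhds t0. F (c t + r t *\<^sub>R z t) = 0"
    by blast
  have "isCont r t0" using r(2) by (rule DERIV_isCont)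
  then have "\<forall>\<^sub>F t in nhds t0. 0 < r t"
    using order_tendstoD(1)[of r "r t0"] l(1) r(1) by (simp add: isCont_iff_tendsto_nhds)
  with r(3) have "\<forall>\<^sub>F t in nhds t0. r t = l t"
    by eventually_elim (use chord_length_unique c z l in blast)
  then show ?thesis
    using r(2) DERIV_cong_ev[of t0 t0 r l r' r'] by auto
qed

section \<open>Curves on the table and variations of a chord\<close>

lemma surface_curve_tangent:
  assumes "(c has_vector_derivative c') (at t0)" "\<forall>\<^sub>F t in nhds t0. F (c t) = 0"
  shows "c' \<bullet> nu (c t0) = 0"
proof -
  have "F (c t0) = 0"
    by (rule eventually_nhds_x_imp_x[OF assms(2)])
  moreover have "c' \<bullet> grad F (c t0) = 0"
    using has_vector_derivative_eventually_const
      [OF has_vector_derivative_compose[OF assms(1) F_has_derivative] assms(2)] .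
  ultimately show ?thesis
    using inner_inner_normal[OF grad_nonzero, of "c t0" c'] grad_nonzero by simp
qed

text \<open>The line through \<open>p\<close> in direction \<open>\<xi>\<close> is pushed back to
  the table along \<open>- nu p\<close>, the direction in which \<open>F\<close> increases. The
  velocity of the resulting curve is tangent, so the correction has derivative zero.\<close>

lemma surface_curve_exists:
  assumes "F p = 0" "\<xi> \<bullet> nu p = 0"
  shows "\<exists>P. P 0 = p \<and> (P has_vector_derivative \<xi>) (at 0) \<and> (\<forall>\<^sub>F t in nhds 0. F (P t) = 0)"
proof -
  define c where "c t = p + t *\<^sub>R \<xi>" for t :: real
  have c: "(c has_vector_derivative \<xi>) (at 0)"
    unfolding c_def by (auto intro!: derivative_eq_intros)
  have "- nu p \<bullet> nu p < 0"
    using norm_nu[OF assms(1)] by (simp add: dot_square_norm)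
  then have "0 < - nu p \<bullet> grad F p"
    using inner_inner_normal[OF grad_nonzero[OF assms(1)], of "- nu p"] grad_nonzero[OF assms(1)]
    by (simp add: mult_pos_pos)
  then obtain r r' where r: "r (0::real) = 0" "(r has_real_derivative r') (at 0)"
    "\<forall>\<^sub>F t in nhds 0. F (c t + r t *\<^sub>R (- nu p)) = 0"
    using chord_selection_differentiable[of c \<xi> 0 "\<lambda>_. - nu p" 0 0] c assms(1)
    by (auto simp: c_def)
  define P where "P t = c t + r t *\<^sub>R (- nu p)" for t
  have P0: "P 0 = p" by (simp add: P_def c_def r)
  have P': "(P has_vector_derivative \<xi> - r' *\<^sub>R nu p) (at 0)"
    unfolding P_def using r(2)[unfolded has_real_derivative_iff_has_vector_derivative] c
    by (auto intro!: derivative_eq_intros r(2))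
  have "(\<xi> - r' *\<^sub>R nu p) \<bullet> nu p = 0"
    using surface_curve_tangent[OF P'] r(3) P0 by (simp add: P_def)
  then have "r' = 0"
    using assms norm_nu[OF assms(1)] by (simp add: inner_diff_left dot_square_norm)
  then show ?thesis
    using P0 P' r(3) by (intro exI[of _ P]) (simp add: P_def)
qed

text \<open>Every first-order variation of the base point and the direction that keeps the entry angle
  is realised by an actual family of chords, so the exit angle has vanishing derivative along it.\<close>
lemma chord_variation:
  assumes p: "F p = 0" and q: "F (p + L *\<^sub>R z) = 0" and "0 < L"
    and z: "norm z = 1" "z \<bullet> nu p = sin \<delta>"
    and Wp: "(nu has_derivative Wp) (at p)" "\<And>x. Wp x \<bullet> nu p = 0"
    and Wq: "(nu has_derivative Wq) (at (p + L *\<^sub>R z))"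
    and \<xi>: "\<xi> \<bullet> nu p = 0" and \<zeta>: "\<zeta> \<bullet> z = 0" "\<zeta> \<bullet> nu p + z \<bullet> Wp \<xi> = 0"
    and \<mu>: "(\<xi> + \<mu> *\<^sub>R z + L *\<^sub>R \<zeta>) \<bullet> nu (p + L *\<^sub>R z) = 0"
  shows "\<zeta> \<bullet> nu (p + L *\<^sub>R z) + z \<bullet> Wq (\<xi> + \<mu> *\<^sub>R z + L *\<^sub>R \<zeta>) = 0"
proof -
  obtain P where P: "P 0 = p" "(P has_vector_derivative \<xi>) (at 0)" "\<forall>\<^sub>F t in nhds 0. F (P t) = 0"
    using surface_curve_exists[OF p \<xi>] by blast
  define n where "n t = nu (P t)" for t
  have n0: "n 0 = nu p" by (simp add: n_def P)
  have nn: "nu p \<bullet> nu p = 1" using norm_nu[OF p] by (simp add: dot_square_norm)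
  have n': "(n has_vector_derivative Wp \<xi>) (at 0)"
    unfolding n_def using has_vector_derivative_compose[OF P(2)] Wp(1) P(1) by simp
  \<comment> \<open>The tangential part, at the moving base point, of the linearly moved direction.
    It is rescaled below because its length need not be exactly \<open>cos \<delta>\<close>.\<close>
  define y where "y t = (z + t *\<^sub>R \<zeta>) - ((z + t *\<^sub>R \<zeta>) \<bullet> n t) *\<^sub>R n t" for t
  have y0: "y 0 = z - sin \<delta> *\<^sub>R nu p" by (simp add: y_def n0 z)
  have zt: "((\<lambda>t. z + t *\<^sub>R \<zeta>) has_vector_derivative \<zeta>) (at 0)"
    by (auto intro!: derivative_eq_intros)
  have "(y has_vector_derivative \<zeta> - ((z \<bullet> nu p) *\<^sub>R Wp \<xi> + (z \<bullet> Wp \<xi> + \<zeta> \<bullet> nu p) *\<^sub>R nu p)) (at 0)"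
    using has_vector_derivative_diff[OF zt bounded_bilinear.has_vector_derivative
        [OF bounded_bilinear_scaleR has_vector_derivative_inner[OF zt n'] n']]
    by (simp add: y_def[abs_def] n0)
  then have y': "(y has_vector_derivative \<zeta> - sin \<delta> *\<^sub>R Wp \<xi>) (at 0)"
    using \<zeta>(2) by (simp add: z add.commute)
  have "(norm (y 0))\<^sup>2 = (cos \<delta>)\<^sup>2"
  proof -
    have "z \<bullet> z = 1" using z(1) by (simp add: norm_eq_1)
    then have "y 0 \<bullet> y 0 = 1 - sin \<delta> * sin \<delta>"
      using z(2) nn by (simp add: y0 inner_diff_left inner_diff_right inner_commute[of "nu p" z])
    then show ?thesis
      unfolding power2_norm_eq_inner cos_squared_eq by (simp add: power2_eq_square)
  qed
  then have ny0: "norm (y 0) = cos \<delta>"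
    using cos_delta_pos by (simp add: power2_eq_iff_nonneg)
  then have "y 0 \<noteq> 0" using cos_delta_pos by auto
  \<comment> \<open>The assumptions on \<open>\<zeta>\<close> say precisely that the length of
    \<open>y\<close> is stationary, so rescaling \<open>y\<close> does not disturb first-order
    terms.\<close>
  have "(\<zeta> - sin \<delta> *\<^sub>R Wp \<xi>) \<bullet> y 0 = - sin \<delta> * (\<zeta> \<bullet> nu p + z \<bullet> Wp \<xi>)"
    using \<zeta>(1) Wp(2)[of \<xi>]
    by (simp add: y0 inner_diff_left inner_diff_right inner_commute[of z "Wp \<xi>"] distrib_left)
  then have "(\<zeta> - sin \<delta> *\<^sub>R Wp \<xi>) \<bullet> sgn (y 0) = 0"
    using \<zeta>(2) by (simp add: sgn_div_norm)
  then have ny': "((\<lambda>t. norm (y t)) has_real_derivative 0) (at 0)"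
    using has_vector_derivative_compose[OF y' has_derivative_norm[OF \<open>y 0 \<noteq> 0\<close>]]
    by (simp add: has_real_derivative_iff_has_vector_derivative)
  have ny'': "((\<lambda>t. cos \<delta> / norm (y t)) has_vector_derivative 0) (at 0)"
    unfolding has_real_derivative_iff_has_vector_derivative[symmetric]
    by (rule derivative_eq_intros ny' refl | use \<open>y 0 \<noteq> 0\<close> in simp)+
  \<comment> \<open>A unit vector with normal component exactly \<open>sin \<delta>\<close>; its
    derivative at \<open>0\<close> is still \<open>\<zeta>\<close>.\<close>
  define u where "u t = sin \<delta> *\<^sub>R n t + (cos \<delta> / norm (y t)) *\<^sub>R y t" for t
  have u0: "u 0 = z"
    using cos_delta_pos ny0 by (simp add: u_def n0 y0)
  have u': "(u has_vector_derivative \<zeta>) (at 0)"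
    using has_vector_derivative_add[OF has_vector_derivative_scaleR[OF DERIV_const[of "sin \<delta>"] n']
        bounded_bilinear.has_vector_derivative[OF bounded_bilinear_scaleR ny'' y']]
      cos_delta_pos
    by (simp add: u_def[abs_def] ny0)
  have "z \<bullet> grad F (p + L *\<^sub>R z) > 0"
    by (rule exit_grad_pos[OF p q \<open>0 < L\<close> z])
  then obtain R R' where R: "R (0::real) = L" "(R has_real_derivative R') (at 0)"
    "\<forall>\<^sub>F t in nhds 0. F (P t + R t *\<^sub>R u t) = 0"
    using chord_selection_differentiable[OF P(2) u', of L] q P(1) u0 by auto
  define Q where "Q t = P t + R t *\<^sub>R u t" for t
  have Q0: "Q 0 = p + L *\<^sub>R z" by (simp add: Q_def R P u0)
  have Q': "(Q has_vector_derivative \<xi> + R' *\<^sub>R z + L *\<^sub>R \<zeta>) (at 0)"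
    using has_vector_derivative_add[OF P(2) has_vector_derivative_scaleR[OF R(2) u']]
    by (simp add: Q_def[abs_def] R(1) u0 ac_simps)
  have zq: "z \<bullet> nu (p + L *\<^sub>R z) = - sin \<delta>"
    by (rule chord_exit_angle[OF p q \<open>0 < L\<close> z])
  \<comment> \<open>The exit curve lies on the table, so its velocity is tangent. Since
    \<open>z\<close> is transversal, this determines \<open>R'\<close>, and \<open>\<mu>\<close>
    solves the same equation.\<close>
  have "(\<xi> + R' *\<^sub>R z + L *\<^sub>R \<zeta>) \<bullet> nu (p + L *\<^sub>R z) = 0"
    using surface_curve_tangent[OF Q'] R(3) Q0 by (simp add: Q_def)
  then have "R' * sin \<delta> = \<mu> * sin \<delta>"
    using \<mu> unfolding inner_add_left inner_scaleR_left zq by linarith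
  then have "R' = \<mu>" using sin_delta_pos by simp
  have Nq: "((\<lambda>t. nu (Q t)) has_vector_derivative Wq (\<xi> + \<mu> *\<^sub>R z + L *\<^sub>R \<zeta>)) (at 0)"
    using has_vector_derivative_compose[OF Q'] Wq Q0 \<open>R' = \<mu>\<close> by simp
  have "isCont R 0" using R(2) by (rule DERIV_isCont)
  then have R_pos: "\<forall>\<^sub>F t in nhds 0. 0 < R t"
    using order_tendstoD(1)[of R "R 0"] \<open>0 < L\<close> R(1) by (simp add: isCont_iff_tendsto_nhds)
  have "isCont y 0" using y' by (rule has_vector_derivative_continuous)
  then have y_ne: "\<forall>\<^sub>F t in nhds 0. y t \<noteq> 0"
    using tendsto_imp_eventually_ne[of y "y 0"] \<open>y 0 \<noteq> 0\<close> by (simp add: isCont_iff_tendsto_nhds)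
  \<comment> \<open>Each nearby member of the family is a chord with entry angle
    \<open>\<delta>\<close>, so its exit angle is constant; differentiating this constant gives the
    claim.\<close>
  have "\<forall>\<^sub>F t in nhds 0. u t \<bullet> nu (Q t) = - sin \<delta>"
    using P(3) R(3) R_pos y_ne
  proof eventually_elim
    case (elim t)
    have nt: "n t \<bullet> n t = 1" using norm_nu[OF elim(1)] by (simp add: n_def dot_square_norm)
    have yn: "y t \<bullet> n t = 0" by (simp add: y_def inner_diff_left nt)
    have un: "u t \<bullet> nu (P t) = sin \<delta>"
      using yn nt by (simp add: u_def inner_add_left n_def[symmetric])
    have "u t \<bullet> u t = (sin \<delta>)\<^sup>2 + (cos \<delta>)\<^sup>2"
      using yn nt elim(4) dot_square_norm[of "y t"]
      by (simp add: u_def inner_add_left inner_add_right inner_commute[of "n t" "y t"] power2_eq_square)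
    then have "norm (u t) = 1"
      by (simp add: norm_eq_1)
    with un show ?case
      unfolding Q_def using chord_exit_angle[OF elim(1,2,3)] by simp
  qed
  from has_vector_derivative_eventually_const[OF has_vector_derivative_inner[OF u' Nq] this]
  show ?thesis by (simp add: u0 Q0 add.commute)
qed

text \<open>\<open>chord_variation\<close> is brought into the form required by
  \<open>exit_frame_algebra\<close>. Self-adjointness at \<open>p\<close> moves the derivative of
  the entry normal from \<open>\<xi>\<close> to \<open>v\<close>; at \<open>q\<close> it moves the
  derivative of the exit normal to \<open>U\<close>, the normalised tangential part of
  \<open>z\<close>. The left side of the first equation is the \<open>X\<close> that collects the
  resulting coefficients.\<close>

lemma exit_frame:
  fixes v :: 'a and L :: real
  assumes p: "F p = 0" and L: "0 < L" and v: "v \<bullet> v = 1" "v \<bullet> nu p = 0"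
    and Wp: "(nu has_derivative Wp) (at p)" "\<And>x. Wp x \<bullet> nu p = 0"
      "\<And>x y. x \<bullet> nu p = 0 \<Longrightarrow> y \<bullet> nu p = 0 \<Longrightarrow> Wp x \<bullet> y = Wp y \<bullet> x"
    and z: "z = cos \<delta> *\<^sub>R v + sin \<delta> *\<^sub>R nu p"
    and q: "F q = 0" "q = p + L *\<^sub>R z"
    and Wq: "(nu has_derivative Wq) (at q)" "\<And>x. Wq x \<bullet> nu q = 0"
      "\<And>x y. x \<bullet> nu q = 0 \<Longrightarrow> y \<bullet> nu q = 0 \<Longrightarrow> Wq x \<bullet> y = Wq y \<bullet> x"
    and U: "cos \<delta> *\<^sub>R U = z + sin \<delta> *\<^sub>R nu q"
  shows "\<exists>\<rho>. (L * cos \<delta>) *\<^sub>R Wq U + (1 + L * cos \<delta> / sin \<delta> * (Wq U \<bullet> z)) *\<^sub>R nu q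
      = - (sin \<delta> *\<^sub>R z) - \<rho> *\<^sub>R (nu p - sin \<delta> *\<^sub>R z) \<and>
    nu q = - (sin \<delta> *\<^sub>R z) + (\<rho> * cos \<delta> / sin \<delta>) *\<^sub>R
      (v - cos \<delta> *\<^sub>R z + L *\<^sub>R (sin \<delta> *\<^sub>R Wp v - (cos \<delta> * (v \<bullet> Wp v)) *\<^sub>R nu p))"
proof -
  have nn: "nu p \<bullet> nu p = 1" "nu q \<bullet> nu q = 1"
    using norm_nu p q by (simp_all add: norm_eq_1[symmetric])
  have nv: "nu p \<bullet> v = 0" using v by (simp add: inner_commute)
  have sc: "sin \<delta> * sin \<delta> + cos \<delta> * cos \<delta> = 1"
    using sin_cos_squared_add[of \<delta>] by (simp add: power2_eq_square)
  have zz: "norm z = 1"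
    unfolding norm_eq_1 z by (simp add: inner_add_left inner_add_right v nv nn sc add.commute)
  have zp: "z \<bullet> nu p = sin \<delta>"
    unfolding z by (simp add: inner_add_left v nn)
  have zq: "z \<bullet> nu q = - sin \<delta>"
    unfolding q(2) by (rule chord_exit_angle) (use p q L zz zp in auto)
  have "cos \<delta> * (U \<bullet> nu q) = 0"
    using arg_cong[OF U, of "\<lambda>x. x \<bullet> nu q"] by (simp add: inner_add_left zq nn)
  then have Uq: "U \<bullet> nu q = 0" using cos_delta_pos by simp
  let ?D = "Wq U"
  let ?X = "(L * cos \<delta>) *\<^sub>R ?D + (1 + L * cos \<delta> / sin \<delta> * (?D \<bullet> z)) *\<^sub>R nu q"
  have Xz: "?X \<bullet> z = - sin \<delta>"
    using sin_delta_pos by (simp add: inner_add_left inner_commute[of "nu q" z] zq field_simps)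
  have var: "L * (\<zeta> \<bullet> ?X) + \<xi> \<bullet> (?X - nu q) = 0"
    if \<xi>: "\<xi> \<bullet> nu p = 0" and \<zeta>: "\<zeta> \<bullet> z = 0" "\<zeta> \<bullet> nu p + cos \<delta> * (Wp v \<bullet> \<xi>) = 0" for \<xi> \<zeta>
  proof -
    \<comment> \<open>The change of chord length that keeps the end point on the table to first
      order, making \<open>\<eta>\<close> tangent at \<open>q\<close>.\<close>
    define \<mu> where "\<mu> = (\<xi> + L *\<^sub>R \<zeta>) \<bullet> nu q / sin \<delta>"
    define \<eta> where "\<eta> = \<xi> + \<mu> *\<^sub>R z + L *\<^sub>R \<zeta>"
    have \<eta>: "\<eta> \<bullet> nu q = 0"
      using sin_delta_pos by (simp add: \<eta>_def \<mu>_def inner_add_left zq)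
    have "z \<bullet> Wp \<xi> = cos \<delta> * (Wp \<xi> \<bullet> v)"
      using Wp(2)[of \<xi>] by (simp add: z inner_add_right inner_commute[of _ "Wp \<xi>"])
    then have "z \<bullet> Wp \<xi> = cos \<delta> * (Wp v \<bullet> \<xi>)"
      using Wp(3)[OF \<xi> v(2)] by simp
    then have "\<zeta> \<bullet> nu q + z \<bullet> Wq \<eta> = 0"
      using chord_variation[OF p q(1)[unfolded q(2)] L zz zp Wp(1,2) Wq(1)[unfolded q(2)] \<xi> \<zeta>(1) _
          \<eta>[unfolded q(2) \<eta>_def]] \<zeta>(2)
      by (simp add: q(2) \<eta>_def)
    moreover have "z \<bullet> Wq \<eta> = cos \<delta> * (?D \<bullet> \<eta>)"
    proof -
      \<comment> \<open>Adding a normal vector to \<open>z\<close> changes nothing because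
        \<open>Wq \<eta>\<close> is tangent; the sum is a tangent vector, as self-adjointness
        requires.\<close>
      have "(z + sin \<delta> *\<^sub>R nu q) \<bullet> Wq \<eta> = z \<bullet> Wq \<eta>"
        using Wq(2)[of \<eta>] by (simp add: inner_add_right inner_commute[of _ "Wq \<eta>"])
      then have "z \<bullet> Wq \<eta> = cos \<delta> * (Wq \<eta> \<bullet> U)"
        unfolding U[symmetric] by (simp add: inner_commute[of _ "Wq \<eta>"])
      then show ?thesis using Wq(3)[OF \<eta> Uq] by simp
    qed
    ultimately have *: "\<zeta> \<bullet> nu q + cos \<delta> * (?D \<bullet> \<xi> + (\<xi> \<bullet> nu q + L * (\<zeta> \<bullet> nu q)) / sin \<delta> * (?D \<bullet> z) + L * (?D \<bullet> \<zeta>)) = 0"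
      by (simp add: \<eta>_def \<mu>_def inner_add_right inner_add_left)
    have "L * (\<zeta> \<bullet> ?X) + \<xi> \<bullet> (?X - nu q) =
      L * (\<zeta> \<bullet> nu q + cos \<delta> * (?D \<bullet> \<xi> + (\<xi> \<bullet> nu q + L * (\<zeta> \<bullet> nu q)) / sin \<delta> * (?D \<bullet> z) + L * (?D \<bullet> \<zeta>)))"
      using sin_delta_pos by (simp add: inner_add_right inner_diff_right inner_commute[of _ ?D] field_simps)
    then show ?thesis unfolding * by simp
  qed
  have "nu q \<bullet> z = - sin \<delta>" using zq by (simp add: inner_commute)
  from exit_frame_algebra[OF v(1) nn(1) v(2) Wp(2) sin_delta_pos cos_delta_pos sc L z this Xz var]
  show ?thesis .
qed

text \<open>Specialisation to the chords along a geodesic, where the bracket in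
  \<open>exit_frame\<close> is \<open>q' - (l' + cos \<delta>) *\<^sub>R z\<close>. Since
  \<open>nu q\<close> has length one and is orthogonal to \<open>q'\<close>, the multiplier is
  computed from \<open>l'\<close>. Pairing with \<open>w\<close>, which is orthogonal to
  \<open>z\<close> and \<open>nu p\<close>, isolates the torsion.\<close>

lemma exit_curve_frame:
  fixes v w :: 'a and L l' k \<tau> :: real
  assumes p: "F p = 0" and L: "0 < L" and v: "v \<bullet> v = 1" "v \<bullet> nu p = 0"
    and Wp: "(nu has_derivative Wp) (at p)" and Wpv: "Wp v = - k *\<^sub>R v + \<tau> *\<^sub>R w"
    and w: "w \<bullet> w = 1" "w \<bullet> v = 0" "w \<bullet> nu p = 0"
    and z: "z = cos \<delta> *\<^sub>R v + sin \<delta> *\<^sub>R nu p"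
    and q: "F q = 0" "q = p + L *\<^sub>R z"
    and Wq: "(nu has_derivative Wq) (at q)"
    and q': "q' = v + l' *\<^sub>R z + L *\<^sub>R ((cos \<delta> * k) *\<^sub>R nu p + sin \<delta> *\<^sub>R (- k *\<^sub>R v + \<tau> *\<^sub>R w))"
    and tangent: "q' \<bullet> nu q = 0"
  defines "\<rho> \<equiv> cos \<delta> / (l' + cos \<delta>)"
  shows "l' + cos \<delta> \<noteq> 0"
    and "nu q = - (sin \<delta> *\<^sub>R z) + (\<rho> * cos \<delta> / sin \<delta>) *\<^sub>R (q' - (l' + cos \<delta>) *\<^sub>R z)"
    and "nu q \<bullet> w = cos \<delta> * \<rho> * L * \<tau>"
    and "Wq q' \<bullet> w = - (1 + L * cos \<delta> / sin \<delta> * \<rho> * (Wq q' \<bullet> z)) * \<tau>"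
    and "z \<bullet> nu q = - sin \<delta>"
proof -
  obtain W where W: "(nu has_derivative W) (at p)" "\<And>x. W x \<bullet> nu p = 0"
      "\<And>x y. x \<bullet> nu p = 0 \<Longrightarrow> y \<bullet> nu p = 0 \<Longrightarrow> W x \<bullet> y = W y \<bullet> x"
    using inner_normal_has_derivative_symmetric[OF Ck_F grad_nonzero[OF p]] by blast
  obtain V where V: "(nu has_derivative V) (at q)" "\<And>x. V x \<bullet> nu q = 0"
      "\<And>x y. x \<bullet> nu q = 0 \<Longrightarrow> y \<bullet> nu q = 0 \<Longrightarrow> V x \<bullet> y = V y \<bullet> x"
    using inner_normal_has_derivative_symmetric[OF Ck_F grad_nonzero[OF q(1)]] by blast
  have "W = Wp" "V = Wq"
    using has_derivative_unique W(1) V(1) Wp Wq by blast+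
  have nn: "nu p \<bullet> nu p = 1" "nu q \<bullet> nu q = 1"
    using norm_nu p q by (simp_all add: norm_eq_1[symmetric])
  have nv: "nu p \<bullet> v = 0" using v by (simp add: inner_commute)
  have sc: "sin \<delta> * sin \<delta> + cos \<delta> * cos \<delta> = 1"
    using sin_cos_squared_add[of \<delta>] by (simp add: power2_eq_square)
  have zz: "norm z = 1"
    unfolding norm_eq_1 z by (simp add: inner_add_left inner_add_right v nv nn sc add.commute)
  have zp: "z \<bullet> nu p = sin \<delta>"
    unfolding z by (simp add: inner_add_left v nn)
  show zq: "z \<bullet> nu q = - sin \<delta>"
    unfolding q(2) by (rule chord_exit_angle) (use p q L zz zp in auto)
  define U where "U = (1 / cos \<delta>) *\<^sub>R (z + sin \<delta> *\<^sub>R nu q)"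
  have U: "cos \<delta> *\<^sub>R U = z + sin \<delta> *\<^sub>R nu q"
    using cos_delta_pos by (simp add: U_def)
  have vWp: "v \<bullet> Wp v = - k"
    using v w by (simp add: Wpv inner_diff_right inner_commute)
  obtain r where r1: "(L * cos \<delta>) *\<^sub>R Wq U + (1 + L * cos \<delta> / sin \<delta> * (Wq U \<bullet> z)) *\<^sub>R nu q
      = - (sin \<delta> *\<^sub>R z) - r *\<^sub>R (nu p - sin \<delta> *\<^sub>R z)"
    and r2: "nu q = - (sin \<delta> *\<^sub>R z) + (r * cos \<delta> / sin \<delta>) *\<^sub>R
      (v - cos \<delta> *\<^sub>R z + L *\<^sub>R (sin \<delta> *\<^sub>R Wp v - (cos \<delta> * (v \<bullet> Wp v)) *\<^sub>R nu p))"
    using exit_frame[OF p L v W z q V U] unfolding \<open>W = Wp\<close> \<open>V = Wq\<close> by blast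
  have "v - cos \<delta> *\<^sub>R z + L *\<^sub>R (sin \<delta> *\<^sub>R Wp v - (cos \<delta> * (v \<bullet> Wp v)) *\<^sub>R nu p)
      = q' - (l' + cos \<delta>) *\<^sub>R z"
    unfolding q' vWp by (simp add: Wpv algebra_simps)
  with r2 have Nq: "nu q = - (sin \<delta> *\<^sub>R z) + (r * cos \<delta> / sin \<delta>) *\<^sub>R (q' - (l' + cos \<delta>) *\<^sub>R z)"
    by simp
  \<comment> \<open>The formula for \<open>nu q\<close> is paired with \<open>nu q\<close> itself;
    \<open>tangent\<close> removes \<open>q'\<close>, and an equation for \<open>r\<close> and
    \<open>l'\<close> remains.\<close>
  have "1 = (- (sin \<delta> *\<^sub>R z) + (r * cos \<delta> / sin \<delta>) *\<^sub>R (q' - (l' + cos \<delta>) *\<^sub>R z)) \<bullet> nu q"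
    using nn(2) Nq by simp
  also have "\<dots> = sin \<delta> * sin \<delta> + r * cos \<delta> * (l' + cos \<delta>)"
    using sin_delta_pos by (simp add: inner_add_left inner_diff_left tangent zq field_simps)
  finally have "cos \<delta> * (r * (l' + cos \<delta>)) = cos \<delta> * cos \<delta>"
    using sc by (simp add: algebra_simps) (use sc in linarith)
  then have rl: "r * (l' + cos \<delta>) = cos \<delta>"
    using cos_delta_pos by simp
  then show ne: "l' + cos \<delta> \<noteq> 0"
    using cos_delta_pos by auto
  then have r: "r = \<rho>"
    using rl by (simp add: \<rho>_def field_simps)
  show Nq': "nu q = - (sin \<delta> *\<^sub>R z) + (\<rho> * cos \<delta> / sin \<delta>) *\<^sub>R (q' - (l' + cos \<delta>) *\<^sub>R z)"
    using Nq r by simp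
  have "r \<noteq> 0" using rl cos_delta_pos by auto
  have zw: "z \<bullet> w = 0" "nu p \<bullet> w = 0" "v \<bullet> w = 0"
    using w(2,3) by (simp_all add: z inner_add_right inner_commute[of _ w])
  have q'w: "q' \<bullet> w = L * (sin \<delta> * \<tau>)"
    unfolding q' by (simp add: inner_add_left inner_diff_left zw w)
  show Nw: "nu q \<bullet> w = cos \<delta> * \<rho> * L * \<tau>"
    using sin_delta_pos by (subst Nq') (simp add: inner_add_left inner_diff_left zw q'w)
  \<comment> \<open>The tangential part of the chord at the exit point is parallel to the velocity
    of the exit curve: in the expression for \<open>U\<close> the coefficient of \<open>z\<close>
    cancels by \<open>rl\<close>. Thus \<open>Wq U\<close> becomes a multiple of
    \<open>Wq q'\<close>.\<close>
  have "cos \<delta> *\<^sub>R U = cos \<delta> *\<^sub>R (r *\<^sub>R q')"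
  proof -
    have "cos \<delta> *\<^sub>R U = z - (sin \<delta> * sin \<delta>) *\<^sub>R z + (r * cos \<delta>) *\<^sub>R (q' - (l' + cos \<delta>) *\<^sub>R z)"
      unfolding U using sin_delta_pos by (subst Nq) (simp add: scaleR_diff_right)
    also have "\<dots> = (1 - sin \<delta> * sin \<delta> - cos \<delta> * (r * (l' + cos \<delta>))) *\<^sub>R z + (cos \<delta> * r) *\<^sub>R q'"
      by (simp add: algebra_simps)
    also have "1 - sin \<delta> * sin \<delta> - cos \<delta> * (r * (l' + cos \<delta>)) = 0"
      using sc by (simp add: rl)
    finally show ?thesis by simp
  qed
  then have "U = r *\<^sub>R q'"
    using cos_delta_pos scaleR_cancel_left[of "cos \<delta>" U "r *\<^sub>R q'"] by simp
  moreover have "linear Wq" using Wq by (rule has_derivative_linear)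
  ultimately have D: "Wq U = \<rho> *\<^sub>R Wq q'"
    by (simp add: linear_cmul r)
  \<comment> \<open>Pairing \<open>r1\<close> with \<open>w\<close> kills its right side; the common
    factor \<open>L * cos \<delta> * \<rho>\<close> is nonzero and is cancelled afterwards.\<close>
  have "(L * cos \<delta>) * (\<rho> * (Wq q' \<bullet> w)) + (1 + L * cos \<delta> / sin \<delta> * (\<rho> * (Wq q' \<bullet> z))) * (cos \<delta> * \<rho> * L * \<tau>) = 0"
    using arg_cong[OF r1, of "\<lambda>x. x \<bullet> w"] by (simp add: inner_add_left inner_diff_left zw D Nw)
  then have "(L * cos \<delta> * \<rho>) * (Wq q' \<bullet> w + (1 + L * cos \<delta> / sin \<delta> * \<rho> * (Wq q' \<bullet> z)) * \<tau>) = 0"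
    by (simp add: algebra_simps)
  then have "Wq q' \<bullet> w + (1 + L * cos \<delta> / sin \<delta> * \<rho> * (Wq q' \<bullet> z)) * \<tau> = 0"
    using L cos_delta_pos \<open>r \<noteq> 0\<close> r by simp
  then show "Wq q' \<bullet> w = - (1 + L * cos \<delta> / sin \<delta> * \<rho> * (Wq q' \<bullet> z)) * \<tau>"
    unfolding mult_minus_left eq_neg_iff_add_eq_0 .
qed

end

section \<open>Continuously differentiable curves and a linear equation\<close>

text \<open>On the real line the vector derivative is the directional derivative in direction
  \<open>1\<close>, so the recursion in \<open>Ck_on\<close> passes smoothness to it.\<close>

lemma smooth_map_on_real_derivative:
  fixes f :: "real \<Rightarrow> 'a::real_normed_vector"
  assumes "smooth_map_on UNIV f"
  shows "(f has_vector_derivative vector_derivative f (at t)) (at t)"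
    and "smooth_map_on UNIV (\<lambda>t. vector_derivative f (at t))"
proof -
  have C: "Ck_on m UNIV f" for m
    using assms by (simp add: smooth_map_on_def)
  have D: "f differentiable at t" for t
    using C[of "Suc 0"] by (simp add: differentiable_on_def)
  then show V: "(f has_vector_derivative vector_derivative f (at t)) (at t)" for t
    by (simp add: vector_derivative_works[symmetric])
  have "vector_derivative f (at t) = frechet_derivative f (at t) 1" for t
    using frechet_derivative_at[OF V[unfolded has_vector_derivative_def]] by (metis scaleR_one)
  moreover have "Ck_on m UNIV (\<lambda>t. frechet_derivative f (at t) 1)" for m
    using C[of "Suc m"] by simp
  ultimately show "smooth_map_on UNIV (\<lambda>t. vector_derivative f (at t))"
    by (simp add: smooth_map_on_def)
qed

lemma smooth_map_on_imp_C1: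
  fixes f :: "real \<Rightarrow> 'a::real_normed_vector"
  assumes "smooth_map_on UNIV f"
  shows "f C1_differentiable_on UNIV"
proof -
  have "Ck_on 0 UNIV (\<lambda>t. vector_derivative f (at t))"
    using smooth_map_on_real_derivative(2)[OF assms] unfolding smooth_map_on_def by blast
  then show ?thesis
    using smooth_map_on_real_derivative(1)[OF assms]
    unfolding C1_differentiable_on_def
    by (intro exI[of _ "\<lambda>t. vector_derivative f (at t)"]) simp
qed

lemma C1_differentiable_imp_continuous:
  "f C1_differentiable_on UNIV \<Longrightarrow> continuous_on UNIV f"
  by (simp add: C1_diff_imp_diff differentiable_imp_continuous_on)

lemma C1_differentiable_on_inner:
  fixes f g :: "real \<Rightarrow> 'a::real_inner"
  assumes "f C1_differentiable_on UNIV" "g C1_differentiable_on UNIV"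
  shows "(\<lambda>t. f t \<bullet> g t) C1_differentiable_on UNIV"
proof -
  obtain f' g' where "\<And>t. (f has_vector_derivative f' t) (at t)" "continuous_on UNIV f'"
    "\<And>t. (g has_vector_derivative g' t) (at t)" "continuous_on UNIV g'"
    using assms unfolding C1_differentiable_on_def by blast
  moreover have "continuous_on UNIV f" "continuous_on UNIV g"
    using assms by (auto intro: C1_differentiable_imp_continuous)
  ultimately show ?thesis
    unfolding C1_differentiable_on_def
    by (intro exI[of _ "\<lambda>t. f t \<bullet> g' t + f' t \<bullet> g t"])
      (auto intro!: has_vector_derivative_inner continuous_intros)
qed

lemma C1_differentiable_on_inverse:
  fixes f :: "real \<Rightarrow> real"
  assumes "f C1_differentiable_on UNIV" "\<And>t. f t \<noteq> 0"
  shows "(\<lambda>t. inverse (f t)) C1_differentiable_on UNIV"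
proof -
  obtain f' where f': "\<And>t. (f has_real_derivative f' t) (at t)" "continuous_on UNIV f'"
    using assms(1) unfolding C1_differentiable_on_def has_real_derivative_iff_has_vector_derivative by blast
  moreover have "continuous_on UNIV f"
    using assms by (auto intro: C1_differentiable_imp_continuous)
  moreover have "((\<lambda>t. inverse (f t)) has_real_derivative - (inverse (f t) * f' t * inverse (f t))) (at t)" for t
    using DERIV_inverse'[OF f'(1) assms(2)] .
  ultimately show ?thesis
    unfolding C1_differentiable_on_def has_real_derivative_iff_has_vector_derivative
    using assms(2) by (intro exI[of _ "\<lambda>t. - (inverse (f t) * f' t * inverse (f t))"])
      (auto intro!: continuous_intros)
qed

lemma C1_differentiable_on_norm:
  fixes f :: "real \<Rightarrow> 'a::real_inner"
  assumes "f C1_differentiable_on UNIV" "\<And>t. f t \<noteq> 0"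
  shows "(\<lambda>t. norm (f t)) C1_differentiable_on UNIV"
proof -
  obtain f' where f': "\<And>t. (f has_vector_derivative f' t) (at t)" "continuous_on UNIV f'"
    using assms(1) unfolding C1_differentiable_on_def by blast
  moreover have "continuous_on UNIV f"
    using assms by (auto intro: C1_differentiable_imp_continuous)
  moreover have "((\<lambda>t. norm (f t)) has_vector_derivative f' t \<bullet> sgn (f t)) (at t)" for t
    using has_vector_derivative_compose[OF f'(1) has_derivative_norm[OF assms(2)]] .
  ultimately show ?thesis
    unfolding C1_differentiable_on_def
    using assms(2) by (intro exI[of _ "\<lambda>t. f' t \<bullet> sgn (f t)"])
      (auto intro!: continuous_intros)
qed

lemma C1_differentiable_on_compose_Ck:
  fixes f :: "'a::euclidean_space \<Rightarrow> real"
  assumes f: "Ck_on (Suc 0) UNIV f" and c: "c C1_differentiable_on UNIV"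
  shows "(\<lambda>t. f (c t)) C1_differentiable_on UNIV"
proof -
  obtain c' where c': "\<And>t. (c has_vector_derivative c' t) (at t)" "continuous_on UNIV c'"
    using c unfolding C1_differentiable_on_def by blast
  have "((\<lambda>t. f (c t)) has_vector_derivative c' t \<bullet> grad f (c t)) (at t)" for t
    by (rule has_vector_derivative_compose[OF c'(1) has_derivative_grad[OF f]])
  moreover have "continuous_on UNIV (grad f)"
    unfolding grad_def[abs_def] by (intro continuous_intros continuous_directional_derivative[OF f])
  then have "continuous_on UNIV (\<lambda>t. c' t \<bullet> grad f (c t))"
    by (intro continuous_intros c'(2) continuous_on_compose2[of UNIV "grad f" UNIV c]
        C1_differentiable_imp_continuous[OF c]) auto
  ultimately show ?thesis
    unfolding C1_differentiable_on_def by (intro exI[of _ "\<lambda>t. c' t \<bullet> grad f (c t)"]) simp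
qed

lemma C1_differentiable_on_sum:
  assumes "finite I" "\<And>i. i \<in> I \<Longrightarrow> f i C1_differentiable_on S"
  shows "(\<lambda>t. \<Sum>i\<in>I. f i t) C1_differentiable_on S"
  using assms by (induction I rule: finite_induct) auto

lemma C1_differentiable_on_inner_normal:
  fixes F :: "'a::euclidean_space \<Rightarrow> real"
  assumes F: "Ck_on (Suc (Suc 0)) UNIV F" and c: "c C1_differentiable_on UNIV"
    and ne: "\<And>t. grad F (c t) \<noteq> 0"
  shows "(\<lambda>t. inner_normal F (c t)) C1_differentiable_on UNIV"
proof -
  have "(\<lambda>t. frechet_derivative F (at (c t)) i) C1_differentiable_on UNIV" for i
    by (rule C1_differentiable_on_compose_Ck[where f = "\<lambda>x. frechet_derivative F (at x) i", OF _ c])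
      (use F in simp)
  then have G: "(\<lambda>t. grad F (c t)) C1_differentiable_on UNIV"
    unfolding grad_def by (intro C1_differentiable_on_sum) auto
  have "(\<lambda>t. inverse (norm (grad F (c t)))) C1_differentiable_on UNIV"
    using ne by (intro C1_differentiable_on_inverse C1_differentiable_on_norm G) auto
  then show ?thesis
    unfolding inner_normal_def divide_inverse using G by simp
qed

text \<open>Integrating factor \<open>exp (- g)\<close> with \<open>g\<close> an antiderivative of
  \<open>C\<close>. The interval \<open>I\<close> covers both \<open>t < t0\<close> and
  \<open>t > t0\<close>.\<close>

lemma linear_ode_zero:
  fixes f C :: "real \<Rightarrow> real"
  assumes f: "\<And>t. (f has_real_derivative C t * f t) (at t)" and C: "continuous_on UNIV C"
    and zero: "f t0 = 0"
  shows "f t = 0"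
proof -
  define I where "I = {min t0 t..max t0 t}"
  obtain g where g: "\<And>x. x \<in> I \<Longrightarrow> (g has_vector_derivative C x) (at x within I)"
    unfolding I_def using antiderivative_continuous[OF continuous_on_subset[OF C subset_UNIV]] by blast
  have "((\<lambda>x. f x * exp (- g x)) has_real_derivative 0) (at x within I)" if "x \<in> I" for x
  proof -
    have g': "(g has_real_derivative C x) (at x within I)"
      using g[OF that] by (simp add: has_real_derivative_iff_has_vector_derivative)
    have f': "(f has_real_derivative C x * f x) (at x within I)"
      using f has_field_derivative_at_within by blast
    show ?thesis
      by (rule derivative_eq_intros f' g' refl | simp)+
  qed
  moreover have "convex I" by (simp add: I_def)
  ultimately obtain c where "\<And>x. x \<in> I \<Longrightarrow> f x * exp (- g x) = c"
    using has_field_derivative_zero_constant[of I "\<lambda>x. f x * exp (- g x)"] by blast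
  moreover have "t0 \<in> I" "t \<in> I" by (auto simp: I_def)
  ultimately have "f t * exp (- g t) = f t0 * exp (- g t0)" by metis
  then show ?thesis using zero by simp
qed

section \<open>The equation for the torsion\<close>

theorem theorem2p4:
  fixes F :: "'a::euclidean_space \<Rightarrow> real"
    and \<delta> :: real
    and \<gamma> v n w :: "real \<Rightarrow> 'a"
    and k \<tau> l :: "real \<Rightarrow> real"
  assumes delta: "0 < \<delta>" "\<delta> < pi / 2"
    and gutkin: "gutkin_table F \<delta>"
    and geod: "arclength_geodesic F \<gamma>"
    and v_def: "\<And>s. v s = vector_derivative \<gamma> (at s)"
    and n_def: "\<And>s. n s = inner_normal F (\<gamma> s)"
    and k_def: "\<And>s. k s = vector_derivative v (at s) \<bullet> n s"
    and w_unit: "\<And>s. norm (w s) = 1"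
    and w_orth: "\<And>s. w s \<bullet> v s = 0" "\<And>s. w s \<bullet> n s = 0"
    and n_deriv: "\<And>s. (n has_vector_derivative (- k s *\<^sub>R v s + \<tau> s *\<^sub>R w s)) (at s)"
    and smooth_tau: "smooth_map_on UNIV \<tau>"
    and smooth_w: "smooth_map_on UNIV w"
    and chord: "\<And>s. l s > 0 \<and>
                  F (\<gamma> s + l s *\<^sub>R (cos \<delta> *\<^sub>R v s + sin \<delta> *\<^sub>R n s)) = 0"
  shows "(\<exists>B :: real \<Rightarrow> real. continuous_on UNIV B \<and>
            (\<forall>s. l s * sin \<delta> * (k s * l s - sin \<delta>) * deriv \<tau> s + B s * \<tau> s = 0))
         \<and> ((\<exists>s0. \<tau> s0 = 0) \<longrightarrow> (\<forall>s. \<tau> s = 0))"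
proof -
  interpret gutkin F \<delta>
    using delta gutkin by unfold_locales

  \<comment> \<open>The geodesic and its frame\<close>
  have sc: "sin \<delta> * sin \<delta> + cos \<delta> * cos \<delta> = 1"
    using sin_cos_squared_add[of \<delta>] by (simp add: power2_eq_square)
  have \<gamma>: "smooth_map_on UNIV \<gamma>" "\<And>s. F (\<gamma> s) = 0"
    "\<And>s. norm (vector_derivative \<gamma> (at s)) = 1"
    "\<And>s. \<exists>c. vector_derivative (\<lambda>r. vector_derivative \<gamma> (at r)) (at s) = c *\<^sub>R nu (\<gamma> s)"
    using geod by (auto simp: arclength_geodesic_def)
  have v_eq: "v = (\<lambda>s. vector_derivative \<gamma> (at s))" by (rule ext) (rule v_def)
  have \<gamma>': "(\<gamma> has_vector_derivative v s) (at s)" for s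
    using smooth_map_on_real_derivative(1)[OF \<gamma>(1)] by (simp add: v_eq)
  have smooth_v: "smooth_map_on UNIV v"
    unfolding v_eq by (rule smooth_map_on_real_derivative(2)[OF \<gamma>(1)])
  have vv: "v s \<bullet> v s = 1" for s
    using \<gamma>(3)[of s] by (simp add: v_eq norm_eq_1)
  have nn: "n s \<bullet> n s = 1" for s
    using norm_nu[OF \<gamma>(2)] by (simp add: n_def norm_eq_1)
  have ww: "w s \<bullet> w s = 1" for s
    using w_unit by (simp add: norm_eq_1)
  have vn: "v s \<bullet> n s = 0" for s
    unfolding n_def by (rule surface_curve_tangent[OF \<gamma>']) (simp add: \<gamma>)
  \<comment> \<open>The acceleration of a geodesic is normal, and pairing with the unit vector
    \<open>n s\<close> identifies its factor as \<open>k s\<close>.\<close>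
  have "vector_derivative v (at s) = k s *\<^sub>R n s" for s
    using \<gamma>(4)[of s] nn[of s] by (auto simp: v_eq[symmetric] n_def[symmetric] k_def)
  then have v': "(v has_vector_derivative k s *\<^sub>R n s) (at s)" for s
    using smooth_map_on_real_derivative(1)[OF smooth_v, of s] by simp

  \<comment> \<open>The chord direction and the exit curve\<close>
  define z where "z s = cos \<delta> *\<^sub>R v s + sin \<delta> *\<^sub>R n s" for s
  define z1 where "z1 s = (cos \<delta> * k s) *\<^sub>R n s + sin \<delta> *\<^sub>R (- k s *\<^sub>R v s + \<tau> s *\<^sub>R w s)" for s
  have z': "(z has_vector_derivative z1 s) (at s)" for s
    unfolding z_def[abs_def] z1_def
    by (rule derivative_eq_intros v' n_deriv refl | simp)+
  have zn: "z s \<bullet> nu (\<gamma> s) = sin \<delta>" for s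
    unfolding n_def[symmetric] by (simp add: z_def inner_add_left vn nn)
  have zz: "norm (z s) = 1" for s
    using sc by (simp add: norm_eq_1 z_def inner_add_left inner_add_right vv nn vn inner_commute[of "n s" "v s"] add.commute)
  have l_pos: "0 < l s" and l_zero: "F (\<gamma> s + l s *\<^sub>R z s) = 0" for s
    using chord by (simp_all add: z_def)
  have "\<exists>l'. (l has_real_derivative l') (at s)" for s
    by (rule chord_length_differentiable[OF \<gamma>(2) \<gamma>' zz zn z' l_pos l_zero])
  then obtain l1 where l': "\<And>s. (l has_real_derivative l1 s) (at s)"
    by metis
  define \<Gamma> where "\<Gamma> s = \<gamma> s + l s *\<^sub>R z s" for s
  define \<Gamma>1 where "\<Gamma>1 s = v s + l1 s *\<^sub>R z s + l s *\<^sub>R z1 s" for s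
  have \<Gamma>': "(\<Gamma> has_vector_derivative \<Gamma>1 s) (at s)" for s
    using has_vector_derivative_add[OF \<gamma>' has_vector_derivative_scaleR[OF l' z']]
    by (simp add: \<Gamma>_def[abs_def] \<Gamma>1_def ac_simps)
  have F\<Gamma>: "F (\<Gamma> s) = 0" for s
    using l_zero by (simp add: \<Gamma>_def)
  define N where "N s = nu (\<Gamma> s)" for s
  define W where "W x = frechet_derivative nu (at x)" for x
  have W: "(nu has_derivative W x) (at x)" if "F x = 0" for x
    using inner_normal_has_derivative_symmetric[OF Ck_F grad_nonzero[OF that]]
    unfolding W_def by (metis frechet_derivative_at)
  have N': "(N has_vector_derivative W (\<Gamma> s) (\<Gamma>1 s)) (at s)" for s
    unfolding N_def[abs_def] by (rule has_vector_derivative_compose[OF \<Gamma>' W[OF F\<Gamma>]])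
  have tangent: "\<Gamma>1 s \<bullet> N s = 0" for s
    unfolding N_def by (rule surface_curve_tangent[OF \<Gamma>']) (simp add: F\<Gamma>)
  \<comment> \<open>The chain rule is compared with \<open>n_deriv\<close>, so that the torsion
    enters through the derivative of the normal in direction \<open>v\<close>.\<close>
  have "((\<lambda>s. nu (\<gamma> s)) has_vector_derivative W (\<gamma> s) (v s)) (at s)" for s
    by (rule has_vector_derivative_compose[OF \<gamma>' W[OF \<gamma>(2)]])
  then have Wv: "W (\<gamma> s) (v s) = - k s *\<^sub>R v s + \<tau> s *\<^sub>R w s" for s
    using n_deriv[of s] vector_derivative_unique_at unfolding n_def[abs_def] by blast

  \<comment> \<open>The exit frame along the geodesic\<close>
  define \<rho> where "\<rho> s = cos \<delta> / (l1 s + cos \<delta>)" for s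
  have w_n: "w s \<bullet> nu (\<gamma> s) = 0" and v_n: "v s \<bullet> nu (\<gamma> s) = 0"
    and z_n: "z s = cos \<delta> *\<^sub>R v s + sin \<delta> *\<^sub>R nu (\<gamma> s)"
    and \<Gamma>1_n: "\<Gamma>1 s = v s + l1 s *\<^sub>R z s +
      l s *\<^sub>R ((cos \<delta> * k s) *\<^sub>R nu (\<gamma> s) + sin \<delta> *\<^sub>R (- k s *\<^sub>R v s + \<tau> s *\<^sub>R w s))" for s
    using w_orth(2)[of s] vn[of s] by (simp_all add: n_def z_def \<Gamma>1_def z1_def)
  note frame = exit_curve_frame[OF \<gamma>(2) l_pos vv v_n W[OF \<gamma>(2)] Wv ww w_orth(1) w_n z_n F\<Gamma> \<Gamma>_def
      W[OF F\<Gamma>] \<Gamma>1_n tangent[unfolded N_def], folded N_def \<rho>_def]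

  \<comment> \<open>Regularity of the exit data\<close>
  have C1v: "v C1_differentiable_on UNIV" and C1\<tau>: "\<tau> C1_differentiable_on UNIV"
    and C1w: "w C1_differentiable_on UNIV" and C1\<gamma>: "\<gamma> C1_differentiable_on UNIV"
    and C1v': "(\<lambda>s. vector_derivative v (at s)) C1_differentiable_on UNIV"
    by (intro smooth_map_on_imp_C1 smooth_v smooth_tau smooth_w \<gamma>(1) smooth_map_on_real_derivative(2))+
  have C1n: "n C1_differentiable_on UNIV"
    unfolding n_def[abs_def] by (rule C1_differentiable_on_inner_normal[OF Ck_F C1\<gamma> grad_nonzero[OF \<gamma>(2)]])
  have C1k: "k C1_differentiable_on UNIV"
    unfolding k_def[abs_def] by (rule C1_differentiable_on_inner[OF C1v' C1n])
  have C1z: "z C1_differentiable_on UNIV" and C1z1: "z1 C1_differentiable_on UNIV"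
    unfolding z_def[abs_def] z1_def[abs_def] using C1v C1n C1k C1\<tau> C1w by simp_all
  \<comment> \<open>Tangency of the exit curve is solved for \<open>l1\<close>. This formula starts
    a bootstrap: \<open>N\<close> and \<open>l\<close> are continuous, so \<open>l1\<close> is
    continuous and \<open>l\<close> is C1; then \<open>\<Gamma>\<close> and \<open>N\<close> are C1,
    and the formula makes \<open>l1\<close>, hence \<open>\<rho>\<close>, C1 as well.\<close>
  have l1_eq: "l1 s = (1 / sin \<delta>) * (v s \<bullet> N s + l s * (z1 s \<bullet> N s))" for s
    using tangent[of s] frame(5)[of s] sin_delta_pos
    by (simp add: \<Gamma>1_def inner_add_left field_simps)
  have contN: "continuous_on UNIV N" and contl: "continuous_on UNIV l"
    using has_vector_derivative_continuous[OF N'] DERIV_isCont[OF l']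
    by (simp_all add: continuous_on_eq_continuous_at)
  have "continuous_on UNIV l1"
    unfolding l1_eq[abs_def]
    by (intro continuous_intros contN contl C1_differentiable_imp_continuous[OF C1v]
        C1_differentiable_imp_continuous[OF C1z1])
  then have C1l: "l C1_differentiable_on UNIV"
    using l' by (auto simp: C1_differentiable_on_def has_real_derivative_iff_has_vector_derivative)
  have C1\<Gamma>: "\<Gamma> C1_differentiable_on UNIV"
    unfolding \<Gamma>_def[abs_def] using C1\<gamma> C1l C1z by simp
  have C1N: "N C1_differentiable_on UNIV"
    unfolding N_def[abs_def] by (rule C1_differentiable_on_inner_normal[OF Ck_F C1\<Gamma> grad_nonzero[OF F\<Gamma>]])
  have C1l1: "l1 C1_differentiable_on UNIV"
    unfolding l1_eq[abs_def]
    by (intro C1_differentiable_on_mult C1_differentiable_on_add C1_differentiable_on_const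
        C1_differentiable_on_inner C1v C1N C1z1 C1l)
  have C1\<rho>: "\<rho> C1_differentiable_on UNIV"
    unfolding \<rho>_def[abs_def] divide_inverse
    using C1_differentiable_on_inverse[of "\<lambda>s. l1 s + cos \<delta>"] frame(1) C1l1 by simp
  obtain \<rho>1 where \<rho>': "\<And>s. (\<rho> has_real_derivative \<rho>1 s) (at s)" "continuous_on UNIV \<rho>1"
    using C1\<rho> unfolding C1_differentiable_on_def has_real_derivative_iff_has_vector_derivative by blast
  obtain w1 where w': "\<And>s. (w has_vector_derivative w1 s) (at s)"
    using C1w unfolding C1_differentiable_on_def by blast
  obtain N1 where N1: "\<And>s. (N has_vector_derivative N1 s) (at s)" "continuous_on UNIV N1"
    using C1N unfolding C1_differentiable_on_def by blast
  have N1_eq: "W (\<Gamma> s) (\<Gamma>1 s) = N1 s" for s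
    using vector_derivative_unique_at[OF N' N1(1)] .
  obtain \<tau>1 where \<tau>': "\<And>s. (\<tau> has_real_derivative \<tau>1 s) (at s)"
    using C1\<tau> unfolding C1_differentiable_on_def has_real_derivative_iff_has_vector_derivative by blast

  \<comment> \<open>The derivative of \<open>w\<close> in the moving frame\<close>
  have w1w: "w1 s \<bullet> w s = 0" for s
  proof -
    have "w s \<bullet> w1 s + w1 s \<bullet> w s = 0"
      by (rule has_vector_derivative_eventually_const[OF has_vector_derivative_inner[OF w' w']]) (simp add: ww)
    then show ?thesis by (simp add: inner_commute)
  qed
  have w1v: "v s \<bullet> w1 s = 0" for s
  proof -
    have "w s \<bullet> (k s *\<^sub>R n s) + w1 s \<bullet> v s = 0"
      by (rule has_vector_derivative_eventually_const[OF has_vector_derivative_inner[OF w' v']]) (simp add: w_orth)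
    then show ?thesis by (simp add: w_orth inner_commute[of "w1 s"])
  qed
  \<comment> \<open>Within the span of \<open>v\<close>, \<open>n\<close> and \<open>w\<close>,
    which contains \<open>N\<close> by \<open>frame(2)\<close>, this is the only nonzero product
    with \<open>w1\<close>. Hence \<open>N \<bullet> w1\<close> is a multiple of
    \<open>\<tau>\<close>.\<close>
  have w1n: "n s \<bullet> w1 s = - \<tau> s" for s
  proof -
    have "w s \<bullet> (- k s *\<^sub>R v s + \<tau> s *\<^sub>R w s) + w1 s \<bullet> n s = 0"
      by (rule has_vector_derivative_eventually_const[OF has_vector_derivative_inner[OF w' n_deriv]]) (simp add: w_orth)
    then show ?thesis by (simp add: inner_diff_right w_orth ww inner_commute[of "w1 s"])
  qed

  \<comment> \<open>Two expressions for the derivative of \<open>N \<bullet> w\<close>\<close>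
  define E where "E s = sin \<delta> * sin \<delta> + (\<rho> s * cos \<delta> / sin \<delta>) * (cos \<delta> * sin \<delta> - l s * (cos \<delta> * k s))" for s
  define g where "g s = 1 + l s * cos \<delta> / sin \<delta> * \<rho> s * (N1 s \<bullet> z s)" for s
  have Nw1: "N s \<bullet> w1 s = E s * \<tau> s" for s
  proof -
    have z_w1: "z s \<bullet> w1 s = - (sin \<delta> * \<tau> s)"
      by (simp add: z_def inner_add_left w1v w1n)
    have z1_w1: "z1 s \<bullet> w1 s = - (cos \<delta> * k s * \<tau> s)"
      using w1w[of s] by (simp add: z1_def inner_add_left inner_diff_left w1v w1n inner_commute[of "w s"])
    \<comment> \<open>The terms with \<open>l1\<close> cancel in this difference, so
      \<open>E\<close> depends on \<open>l1\<close> only through \<open>\<rho>\<close>.\<close>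
    have \<Gamma>1_w1: "(\<Gamma>1 s - (l1 s + cos \<delta>) *\<^sub>R z s) \<bullet> w1 s = (cos \<delta> * sin \<delta> - l s * (cos \<delta> * k s)) * \<tau> s"
      by (simp add: \<Gamma>1_def inner_add_left inner_diff_left z_w1 z1_w1 w1v algebra_simps)
    show ?thesis
      unfolding frame(2)[of s] inner_add_left inner_minus_left inner_scaleR_left z_w1 \<Gamma>1_w1 E_def
      by (simp add: distrib_right)
  qed
  have Nw: "N s \<bullet> w s = cos \<delta> * (\<rho> s * (l s * \<tau> s))" for s
    using frame(3)[of s] by simp
  \<comment> \<open>Both sides of \<open>Nw\<close> are differentiated. On the side of the inner
    product, \<open>Nw1\<close> and \<open>frame(4)\<close> make each of the two terms a multiple of
    \<open>\<tau>\<close>.\<close>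
  have ode: "cos \<delta> * (\<rho>1 s * (l s * \<tau> s) + \<rho> s * (l1 s * \<tau> s + l s * \<tau>1 s)) = E s * \<tau> s - g s * \<tau> s" for s
  proof -
    have "((\<lambda>s. cos \<delta> * (\<rho> s * (l s * \<tau> s))) has_vector_derivative
        cos \<delta> * (\<rho>1 s * (l s * \<tau> s) + \<rho> s * (l1 s * \<tau> s + l s * \<tau>1 s))) (at s)"
      unfolding has_real_derivative_iff_has_vector_derivative[symmetric]
      by (rule derivative_eq_intros \<rho>'(1) l' \<tau>' refl | simp add: algebra_simps)+
    moreover have "((\<lambda>s. N s \<bullet> w s) has_vector_derivative N s \<bullet> w1 s + N1 s \<bullet> w s) (at s)"
      by (rule has_vector_derivative_inner[OF N1(1) w'])
    ultimately have "cos \<delta> * (\<rho>1 s * (l s * \<tau> s) + \<rho> s * (l1 s * \<tau> s + l s * \<tau>1 s)) = N s \<bullet> w1 s + N1 s \<bullet> w s"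
      unfolding Nw using vector_derivative_unique_at by blast
    also have "N1 s \<bullet> w s = - g s * \<tau> s"
      using frame(4)[of s] unfolding N1_eq g_def .
    finally show ?thesis by (simp add: Nw1)
  qed

  \<comment> \<open>The linear equation for the torsion\<close>
  have \<rho>_ne: "\<rho> s \<noteq> 0" for s
    using frame(1)[of s] cos_delta_pos by (simp add: \<rho>_def)
  \<comment> \<open>Obtained by solving \<open>ode\<close> for \<open>\<tau>1\<close>. The
    denominator has no zeros, so \<open>C\<close> is defined and continuous everywhere, also where
    \<open>k s * l s = sin \<delta>\<close>.\<close>
  define C where "C s = (E s - g s - cos \<delta> * (\<rho>1 s * l s + \<rho> s * l1 s)) / (cos \<delta> * (\<rho> s * l s))" for s
  have C: "\<tau>1 s = C s * \<tau> s" for s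
  proof -
    have "cos \<delta> * (\<rho> s * l s) * \<tau>1 s = (E s - g s - cos \<delta> * (\<rho>1 s * l s + \<rho> s * l1 s)) * \<tau> s"
      using ode[of s] by (simp add: algebra_simps)
    then show ?thesis
      using \<rho>_ne[of s] l_pos[of s] cos_delta_pos unfolding C_def
      by (simp add: eq_divide_eq mult.commute)
  qed
  have cont: "continuous_on UNIV \<rho>" "continuous_on UNIV l1" "continuous_on UNIV k" "continuous_on UNIV z"
    by (intro C1_differentiable_imp_continuous C1\<rho> C1l1 C1k C1z)+
  have contC: "continuous_on UNIV C"
    unfolding C_def[abs_def] E_def g_def
    using \<rho>_ne l_pos cos_delta_pos sin_delta_pos
    by (intro continuous_intros cont contl \<rho>'(2) N1(2)) (auto simp: less_imp_neq[symmetric])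
  \<comment> \<open>\<open>B\<close> is minus the coefficient of \<open>deriv \<tau> s\<close> times
    \<open>C s\<close>: the equation \<open>\<tau>1 s = C s * \<tau> s\<close> is multiplied by that
    coefficient.\<close>
  have "l s * sin \<delta> * (k s * l s - sin \<delta>) * deriv \<tau> s
      + - (l s * sin \<delta> * (k s * l s - sin \<delta>) * C s) * \<tau> s = 0" for s
    using DERIV_imp_deriv[OF \<tau>'] by (simp add: C)
  moreover have "continuous_on UNIV (\<lambda>s. - (l s * sin \<delta> * (k s * l s - sin \<delta>) * C s))"
    by (intro continuous_intros cont contl contC)
  moreover have "\<tau> s = 0" if "\<tau> s0 = 0" for s s0
    using linear_ode_zero[of \<tau> C s0 s] \<tau>' contC that by (simp add: C)
  ultimately show ?thesis by blast
qed

end
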